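(* Suppose $p$ and $q$ are fixed odd primes with $p<q$, and let $\epsilon>0$. Then for all sufficiently large integers $r$ having no odd prime divisor less than $p$, we have \[ \frac{E_1(pqr)}{E(pqr)} > \frac{2^p - 2}{p2^q + 2^p - 2} - \epsilon. \]
   Context: A Reuleaux polygon is a closed convex region in the plane of constant width whose boundary consists of a finite number of circular arcs, each with the same curvature; its vertices are the points where two adjacent arcs of its boundary meet (there is an odd number of them). Connecting all pairs of vertices of a Reuleaux polygon $R$ at maximal distance from one another gives a star polygon $S$: a closed path consisting of an odd number of line segments, each intersecting all the others, all of length equal to the diameter of $R$; the angles at its vertices sum to $\pi$. Let $n\ge 3$ be an integer, not a power of two. A Reinhardt polygon with $n$ sides is an equilateral convex $n$-gon $P$ that can be inscribed in a Reuleaux polygon $R$ having the same diameter as $P$ in such a way that every vertex of $R$ is a vertex of $P$. If $S$ has $m$ vertices ($m$ odd), the angle of $S$ at each vertex $v$ equals $k\pi/n$, where $k$ is the number of sides of $P$ inscribed in the arc of $R$ opposite $v$. Reading off these integers while traversing $S$ gives a composition $[k_1,\dots,k_m]$ of $n$ into an odd number $m$ of positive parts. Two compositions are equivalent if one is obtained from the other by a combination of cyclic shifts and list reversals (corresponding to rotations and flips of the polygon); an equivalence class is called a dihedral composition. Characterization (Reinhardt): a composition $[k_1,\dots,k_m]$ of $n$ with $m$ odd corresponds to a Reinhardt polygon if and only if $\Phi_{2n}(z)$ divides $F(z)=1-z^{k_1}+z^{k_1+k_2}-\cdots+z^{k_1+\cdots+k_{m-1}}$, where $\Phi_j$ is the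 $j$th cyclotomic polynomial. A Reinhardt polygon is periodic if its dihedral composition is periodic, i.e. has the form $[(k_1,\dots,k_s)^d]$ (the list $k_1,\dots,k_s$ repeated $d$ times) for some integer $d>1$; otherwise it is sporadic. $E(n)$ denotes the number of all Reinhardt polygons with $n$ sides and $E_1(n)$ the number of sporadic ones; in both counts two polygons are distinct only if one cannot be obtained from the other by a combination of rotations and flips (i.e. one counts the corresponding dihedral compositions). *)

theory Defs
  imports "HOL-Complex_Analysis.Complex_Analysis"
begin

text \<open>The plane is the type \<^typ>\<open>complex\<close>.\<close>

definition constant_width :: "complex set \<Rightarrow> bool" where
  "constant_width R \<longleftrightarrow>
     (\<exists>w. \<forall>u. norm u = 1 \<longrightarrow> (SUP x\<in>R. x \<bullet> u) - (INF x\<in>R. x \<bullet> u) = w)"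

definition circular_arc :: "real \<Rightarrow> complex set \<Rightarrow> bool" where
  "circular_arc \<rho> A \<longleftrightarrow>
     (\<exists>c s t. s < t \<and> t < s + 2 * pi \<and> A = path_image (part_circlepath c \<rho> s t))"

text \<open>
  The second argument is the set of boundary arcs. Arcs that meet are required to lie on
  different circles: this makes the arcs maximal, so that the vertices below are genuine corners
  (an arc cannot be subdivided at will), and it excludes the disc.
\<close>

definition reuleaux_polygon :: "complex set \<Rightarrow> complex set set \<Rightarrow> bool" where
  "reuleaux_polygon R \<A> \<longleftrightarrow>
     compact R \<and> convex R \<and> interior R \<noteq> {} \<and> constant_width R \<and>
     finite \<A> \<and> frontier R = \<Union>\<A> \<and>
     (\<exists>\<rho>>0. (\<forall>A\<in>\<A>. circular_arc \<rho> A) \<and>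
        (\<forall>A\<in>\<A>. \<forall>B\<in>\<A>. A \<noteq> B \<longrightarrow> A \<inter> B \<noteq> {} \<longrightarrow>
           \<not> (\<exists>c. A \<subseteq> sphere c \<rho> \<and> B \<subseteq> sphere c \<rho>)))"

definition arc_vertices :: "complex set set \<Rightarrow> complex set" where
  "arc_vertices \<A> = {x. \<exists>A\<in>\<A>. \<exists>B\<in>\<A>. A \<noteq> B \<and> x \<in> A \<inter> B}"

definition polygon_vertices :: "complex set \<Rightarrow> complex set" where
  "polygon_vertices P = {v. v extreme_point_of P}"

text \<open>A polygon is the closed region, i.e. a two-dimensional polytope; its sides are its edges.\<close>

definition equilateral_convex_polygon :: "nat \<Rightarrow> complex set \<Rightarrow> bool" where
  "equilateral_convex_polygon n P \<longleftrightarrow>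
     polytope P \<and> aff_dim P = 2 \<and> card (polygon_vertices P) = n \<and>
     (\<exists>l. \<forall>e. e edge_of P \<longrightarrow> diameter e = l)"

text \<open>
  \<open>P\<close> is inscribed in the Reuleaux polygon \<open>R\<close> with boundary arcs \<open>\<A>\<close> in the way required of a
  Reinhardt polygon.
\<close>

definition reinhardt_inscribed :: "complex set \<Rightarrow> complex set \<Rightarrow> complex set set \<Rightarrow> bool" where
  "reinhardt_inscribed P R \<A> \<longleftrightarrow>
     reuleaux_polygon R \<A> \<and> P \<subseteq> R \<and> polygon_vertices P \<subseteq> frontier R \<and>
     diameter P = diameter R \<and> arc_vertices \<A> \<subseteq> polygon_vertices P"

definition reinhardt_polygon :: "nat \<Rightarrow> complex set \<Rightarrow> bool" where
  "reinhardt_polygon n P \<longleftrightarrow>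
     equilateral_convex_polygon n P \<and> (\<exists>R \<A>. reinhardt_inscribed P R \<A>)"

text \<open>
  The list \<open>vs\<close> traverses the star polygon obtained by connecting all pairs of points of \<open>V\<close> at
  distance \<open>D\<close>.
\<close>

definition star_polygon :: "complex set \<Rightarrow> real \<Rightarrow> complex list \<Rightarrow> bool" where
  "star_polygon V D vs \<longleftrightarrow>
     (let m = length vs; side = (\<lambda>i. {vs ! i, vs ! (Suc i mod m)}) in
        distinct vs \<and> set vs = V \<and> odd m \<and>
        {{x, y} | x y. x \<in> V \<and> y \<in> V \<and> dist x y = D} = {side i | i. i < m} \<and>
        (\<forall>i<m. \<forall>j<m. convex hull (side i) \<inter> convex hull (side j) \<noteq> {}))"

definition angle_at :: "complex \<Rightarrow> complex \<Rightarrow> complex \<Rightarrow> real" where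
  "angle_at v a b = arccos ((a - v) \<bullet> (b - v) / (norm (a - v) * norm (b - v)))"

definition odd_composition :: "nat \<Rightarrow> nat list \<Rightarrow> bool" where
  "odd_composition n ks \<longleftrightarrow> sum_list ks = n \<and> 0 \<notin> set ks \<and> odd (length ks)"

text \<open>
  The part \<open>k\<close> read off at a vertex of the star polygon is given by its angle \<open>k * pi / n\<close> there;
  \<open>k\<close> is then also the number of sides of \<open>P\<close> inscribed in the arc of \<open>R\<close> opposite that vertex.
\<close>

definition reinhardt_composition :: "nat \<Rightarrow> complex set \<Rightarrow> nat list \<Rightarrow> bool" where
  "reinhardt_composition n P ks \<longleftrightarrow>
     reinhardt_polygon n P \<and> odd_composition n ks \<and>
     (\<exists>R \<A> vs. reinhardt_inscribed P R \<A> \<and> star_polygon (arc_vertices \<A>) (diameter R) vs \<and>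
        length vs = length ks \<and>
        (let m = length vs in
         \<forall>i<m. angle_at (vs ! i) (vs ! ((i + m - 1) mod m)) (vs ! (Suc i mod m))
                  = real (ks ! i) * pi / real n))"

definition dihedral_class :: "nat list \<Rightarrow> nat list set" where
  "dihedral_class ks = {rotate j ks | j. True} \<union> {rotate j (rev ks) | j. True}"

definition periodic_dihedral :: "nat list set \<Rightarrow> bool" where
  "periodic_dihedral C \<longleftrightarrow> (\<exists>d us. d > 1 \<and> concat (replicate d us) \<in> C)"

text \<open>Reinhardt polygons up to rotations and flips, represented by their dihedral compositions.\<close>

definition reinhardt_classes :: "nat \<Rightarrow> nat list set set" where
  "reinhardt_classes n = {dihedral_class ks | P ks. reinhardt_composition n P ks}"

definition num_reinhardt :: "nat \<Rightarrow> nat" where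
  "num_reinhardt n = card (reinhardt_classes n)"

definition num_sporadic :: "nat \<Rightarrow> nat" where
  "num_sporadic n = card {C \<in> reinhardt_classes n. \<not> periodic_dihedral C}"

end

theory Submission
  imports Defs
begin

text \<open>
  Let \<open>n = p q r\<close> and \<open>\<omega> = cis (\<pi>/n)\<close>. An odd composition of \<open>n\<close> is the list of run lengths of a sign
  sequence \<open>\<sigma>\<close> on \<open>{0..<n}\<close> with equal first and last sign, and the root condition of Reinhardt's
  characterization becomes \<open>\<Sum>j<n. \<sigma> j * \<omega>^j = 0\<close>. This holds as soon as, on every residue
  class modulo \<open>r\<close>, the sequence multiplied by alternating signs is periodic modulo \<open>p\<close> or modulo
  \<open>q\<close>. Allowing all \<open>q\<close>-periodic patterns and a single \<open>p\<close>-periodic one on all but two residue classes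
  already gives \<open>(2^q + 1)^(r - 2)\<close> compositions, whereas at most \<open>n 2^(q r)\<close> compositions are
  periodic, because every odd divisor \<open>d > 1\<close> of \<open>n\<close> is at least \<open>p\<close>. A dihedral class has at most
  \<open>2 n\<close> members, so the fraction of periodic classes tends to \<open>0\<close>; the asserted bound follows since
  its right-hand side without \<open>\<epsilon>\<close> is at most \<open>1\<close>.

  Only the sufficiency of the root condition is needed, that is, the construction of a polygon from
  a composition. The condition says that the star closes up. Prescribing the boundary point
  \<open>\<gamma> \<theta>\<close> with outer normal \<open>cis \<theta>\<close> to rest at a vertex of the star and to turn around the opposite
  vertex alternately gives \<open>\<gamma> \<theta> - \<gamma> (\<theta> + \<pi>) = cis \<theta>\<close>, hence a body of constant width \<open>1\<close> in which
  every direction has a unique support point. The polygon is spanned by the points \<open>\<gamma> (j \<pi>/n)\<close>.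
\<close>

section \<open>The support map of a closed star\<close>

lemma inner_cis [simp]: "cis a \<bullet> cis b = cos (a - b)"
  by (simp add: inner_complex_def cos_diff)

lemma unit_eq_cis:
  fixes u :: complex
  assumes "norm u = 1"
  obtains \<theta> where "0 \<le> \<theta>" "u = cis \<theta>"
  using assms Arg2pi_eq[of u] Arg2pi_ge_0[of u] by (metis cis_conv_exp mult.left_neutral of_real_1)

lemma cis_add_pi [simp]: "cis (\<theta> + pi) = - cis \<theta>"
  by (simp add: complex_eq_iff)

lemma cis_add_2pi_nat: "cis (\<theta> + 2 * pi * real k) = cis \<theta>"
  using cis_multiple_2pi[of "real k"] by (simp add: cis_mult[symmetric])

lemma diameter_segment:
  fixes a b :: "'a :: euclidean_space"
  shows "diameter (convex hull {a, b}) = dist a b"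
proof (rule antisym)
  show "diameter (convex hull {a, b}) \<le> dist a b"
  proof (intro diameter_le)
    fix x y assume "x \<in> convex hull {a, b}" "y \<in> convex hull {a, b}"
    then obtain u v where uv: "x = (1 - u) *\<^sub>R a + u *\<^sub>R b" "y = (1 - v) *\<^sub>R a + v *\<^sub>R b"
      "0 \<le> u" "u \<le> 1" "0 \<le> v" "v \<le> 1"
      unfolding segment_convex_hull[symmetric] by (auto simp: in_segment)
    have "x - y = (v - u) *\<^sub>R (a - b)"
      by (simp add: uv algebra_simps)
    then have "norm (x - y) = \<bar>v - u\<bar> * dist a b"
      by (simp add: dist_norm)
    also have "\<dots> \<le> dist a b"
      using uv by (intro mult_left_le_one_le) auto
    finally show "norm (x - y) \<le> dist a b" .
  qed simp
  have "bounded (convex hull {a, b})"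
    by (simp add: bounded_convex_hull)
  then show "dist a b \<le> diameter (convex hull {a, b})"
    by (intro diameter_bounded_bound) (auto simp: hull_inc)
qed

lemma diff_scaleR_in_segment:
  fixes a v :: "'a :: real_vector"
  assumes "0 \<le> t" "0 \<le> 1 - t"
  shows "a - t *\<^sub>R v \<in> closed_segment a (a - v)"
  unfolding in_segment using assms by (intro exI[of _ t]) (simp add: algebra_simps)

text \<open>Three points determine a circle: with \<open>d = u - c\<close> the assumption reads
  \<open>2 * (d \<bullet> cis \<theta>) = - (d \<bullet> d)\<close>, and comparing the two ends of
  the arc with its midpoint leaves \<open>d \<bullet> d = cos \<delta> * (d \<bullet> d)\<close>
  with \<open>cos \<delta> < 1\<close>.\<close>

lemma cis_arc_center_unique:
  assumes "s < t" "t < s + pi" "\<And>\<theta>. s \<le> \<theta> \<Longrightarrow> \<theta> \<le> t \<Longrightarrow> dist c (u + cis \<theta>) = 1"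
  shows "c = u"
proof -
  define d where "d = u - c"
  have const: "2 * (d \<bullet> cis \<theta>) = - (d \<bullet> d)" if "s \<le> \<theta>" "\<theta> \<le> t" for \<theta>
  proof -
    have "norm (d + cis \<theta>) = 1"
      using assms(3)[OF that] norm_minus_commute[of c "u + cis \<theta>"]
      by (simp add: d_def dist_norm algebra_simps)
    then have "(d + cis \<theta>) \<bullet> (d + cis \<theta>) = 1"
      by (simp add: power2_norm_eq_inner[symmetric])
    then show ?thesis
      by (simp add: inner_add_left inner_add_right inner_commute)
  qed
  define \<mu> where "\<mu> = (s + t) / 2"
  define \<delta> where "\<delta> = (t - s) / 2"
  have "cis s + cis t = (2 * cos \<delta>) *\<^sub>R cis \<mu>"
  proof -
    have "(s - t) / 2 = - \<delta>"
      by (simp add: \<delta>_def field_simps)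
    then show ?thesis
      using cos_plus_cos[of s t] sin_plus_sin[of s t] by (simp add: complex_eq_iff \<mu>_def)
  qed
  then have "d \<bullet> cis s + d \<bullet> cis t = 2 * cos \<delta> * (d \<bullet> cis \<mu>)"
    by (simp add: inner_add_right[symmetric])
  moreover have "2 * (d \<bullet> cis s) = - (d \<bullet> d)" "2 * (d \<bullet> cis t) = - (d \<bullet> d)"
    "2 * (d \<bullet> cis \<mu>) = - (d \<bullet> d)"
    by (rule const; use assms(1) in \<open>simp add: \<mu>_def\<close>)+
  moreover from this(3) have "2 * cos \<delta> * (d \<bullet> cis \<mu>) = cos \<delta> * - (d \<bullet> d)"
    by (metis mult.assoc mult.left_commute)
  ultimately have "d \<bullet> d = cos \<delta> * (d \<bullet> d)"
    by linarith
  then have "(d \<bullet> d) * (1 - cos \<delta>) = 0"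
    by (simp only: right_diff_distrib) simp
  moreover have "cos \<delta> < cos 0"
    using assms by (intro cos_monotone_0_pi) (auto simp: \<delta>_def)
  ultimately show ?thesis
    by (simp add: d_def)
qed

text \<open>
  \<open>U\<close> lists the vertices of the star and \<open>K\<close> the partial sums of the composition, both continued
  periodically past \<open>m\<close>. On the \<open>i\<close>-th run, the interval from \<open>\<pi> K i / n\<close> to \<open>\<pi> K (i + 1) / n\<close> of
  normal directions, the boundary point turns around \<open>U i\<close> if \<open>i\<close> is even and rests at \<open>U i\<close> if \<open>i\<close> is
  odd; as \<open>m\<close> is odd, opposite runs have different parity.
\<close>

locale closed_star =
  fixes n m :: nat and K :: "nat \<Rightarrow> nat" and U :: "nat \<Rightarrow> complex"
  assumes odd_m: "odd m"
    and K_0: "K 0 = 0"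
    and K_less_Suc: "K i < K (Suc i)"
    and K_add: "K (i + m) = K i + n"
    and U_Suc: "U (Suc i) = U i + (-1) ^ i * cis (pi * real (K (Suc i)) / real n)"
    and U_add: "U (i + m) = U i"
begin

definition \<alpha> :: "nat \<Rightarrow> real" where
  "\<alpha> i = pi * real (K i) / real n"

text \<open>Runs are half-open, so a breakpoint belongs to the later run. Negative parameters all
  get run 0, so \<open>\<gamma>\<close> is only meaningful for nonnegative ones.\<close>

definition run :: "real \<Rightarrow> nat" where
  "run \<theta> = (LEAST i. \<theta> < \<alpha> (Suc i))"

text \<open>
  The support map: for \<open>\<theta> \<ge> 0\<close>, the boundary point at which \<open>cis \<theta>\<close> is an outer normal.
\<close>

definition \<gamma> :: "real \<Rightarrow> complex" where
  "\<gamma> \<theta> = U (run \<theta>) + (if even (run \<theta>) then cis \<theta> else 0)"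

lemma K_mono: "strict_mono K"
  by (simp add: K_less_Suc strict_mono_Suc_iff)

lemma n_pos: "n > 0"
proof -
  have "K 0 < K (0 + m)"
    using odd_m odd_pos by (intro strict_monoD[OF K_mono]) simp
  then show ?thesis using K_add[of 0] K_0 by simp
qed

lemma U_Suc': "U (Suc i) = U i + (-1) ^ i * cis (\<alpha> (Suc i))"
  by (simp add: U_Suc \<alpha>_def)

lemma m_ge_3: "m \<ge> 3"
proof -
  have "m \<noteq> 1"
  proof
    assume "m = 1"
    then have "cis (\<alpha> (Suc 0)) = 0"
      using U_Suc'[of 0] U_add[of 0] by simp
    then show False
      using cis_neq_zero by blast
  qed
  then show ?thesis
    using odd_m by (cases "m = 2") (auto elim!: oddE)
qed

lemma \<alpha>_0 [simp]: "\<alpha> 0 = 0"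
  by (simp add: \<alpha>_def K_0)

lemma \<alpha>_less_Suc: "\<alpha> i < \<alpha> (Suc i)"
  using K_less_Suc[of i] n_pos by (simp add: \<alpha>_def divide_strict_right_mono)

lemma \<alpha>_mono: "strict_mono \<alpha>"
  by (simp add: \<alpha>_less_Suc strict_mono_Suc_iff)

lemma \<alpha>_le_iff [simp]: "\<alpha> i \<le> \<alpha> j \<longleftrightarrow> i \<le> j" and \<alpha>_less_iff [simp]: "\<alpha> i < \<alpha> j \<longleftrightarrow> i < j"
  using \<alpha>_mono strict_mono_less_eq strict_mono_less by blast+

lemma \<alpha>_ge_0 [simp]: "\<alpha> i \<ge> 0"
  by (simp add: \<alpha>_def)

lemma \<alpha>_add: "\<alpha> (i + m) = \<alpha> i + pi"
  using n_pos by (simp add: \<alpha>_def K_add field_simps)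

lemma \<alpha>_unbounded: "\<exists>i. \<theta> < \<alpha> (Suc i)"
proof -
  have K: "i \<le> K i" for i
    using K_mono by (simp add: strict_mono_imp_increasing)
  obtain i where i: "\<theta> * real n / pi < real i"
    using reals_Archimedean2 by blast
  also have "\<dots> \<le> real (K (Suc i))"
    using K[of "Suc i"] by linarith
  finally have "\<theta> < \<alpha> (Suc i)"
    using n_pos by (simp add: \<alpha>_def field_simps)
  then show ?thesis ..
qed

lemma less_\<alpha>_run: "\<theta> < \<alpha> (Suc (run \<theta>))"
  unfolding run_def by (rule LeastI_ex[OF \<alpha>_unbounded])

lemma \<alpha>_run_le: "0 \<le> \<theta> \<Longrightarrow> \<alpha> (run \<theta>) \<le> \<theta>"
proof (cases "run \<theta>")
  case (Suc i)
  then have "\<not> \<theta> < \<alpha> (Suc i)"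
    unfolding run_def using not_less_Least lessI by metis
  then show ?thesis using Suc by simp
qed simp

lemma run_eqI:
  assumes "\<alpha> i \<le> \<theta>" "\<theta> < \<alpha> (Suc i)"
  shows "run \<theta> = i"
  unfolding run_def
proof (rule Least_equality)
  fix j assume "\<theta> < \<alpha> (Suc j)"
  then have "\<alpha> i < \<alpha> (Suc j)" using assms by linarith
  then show "i \<le> j" by simp
qed (rule assms)

text \<open>The formula of a run remains right at its closed right end: by \<open>U_Suc'\<close>,
  turning around \<open>U i\<close> ends at \<open>U (Suc i)\<close>, where the next run rests, and
  resting at \<open>U i\<close> ends where turning around \<open>U (Suc i)\<close> starts.\<close>

lemma \<gamma>_eq:
  assumes "\<alpha> i \<le> \<theta>" "\<theta> \<le> \<alpha> (Suc i)"
  shows "\<gamma> \<theta> = U i + (if even i then cis \<theta> else 0)"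
proof (cases "\<theta> < \<alpha> (Suc i)")
  case True
  then show ?thesis using assms run_eqI by (simp add: \<gamma>_def)
next
  case False
  then have \<theta>: "\<theta> = \<alpha> (Suc i)" using assms by simp
  then have "run \<theta> = Suc i" by (intro run_eqI) simp_all
  then show ?thesis
    using \<theta> by (simp add: \<gamma>_def U_Suc')
qed

lemma \<gamma>_\<alpha>_Suc: "\<gamma> (\<alpha> (Suc i)) = (if even i then U (Suc i) else U i)"
  using \<gamma>_eq[of i "\<alpha> (Suc i)"] U_Suc'[of i] by simp

text \<open>A half-turn advances the run by \<open>m\<close>. This keeps the vertex but,
  \<open>m\<close> being odd, exchanges turning and resting.\<close>

lemma \<gamma>_add_pi:
  assumes "0 \<le> \<theta>"
  shows "\<gamma> (\<theta> + pi) = \<gamma> \<theta> - cis \<theta>"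
proof -
  let ?i = "run \<theta>"
  have "\<gamma> (\<theta> + pi) = U (?i + m) + (if even (?i + m) then cis (\<theta> + pi) else 0)"
    using less_\<alpha>_run[of \<theta>] \<alpha>_run_le[OF assms] \<alpha>_add[of "Suc ?i"] by (intro \<gamma>_eq) (simp_all add: \<alpha>_add)
  also have "\<dots> = \<gamma> \<theta> - cis \<theta>"
    using odd_m by (simp add: \<gamma>_def U_add)
  finally show ?thesis .
qed

lemma \<gamma>_add_2pi:
  assumes "0 \<le> \<theta>"
  shows "\<gamma> (\<theta> + 2 * pi) = \<gamma> \<theta>"
proof -
  have "\<gamma> (\<theta> + 2 * pi) = \<gamma> (\<theta> + pi + pi)"
    by (rule arg_cong[where f = \<gamma>]) simp
  also have "\<dots> = \<gamma> (\<theta> + pi) - cis (\<theta> + pi)"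
    using assms by (intro \<gamma>_add_pi) simp
  also have "\<dots> = \<gamma> \<theta>"
    using assms by (simp add: \<gamma>_add_pi)
  finally show ?thesis .
qed

lemma \<gamma>_add_2pi_nat: "0 \<le> \<theta> \<Longrightarrow> \<gamma> (\<theta> + 2 * pi * real k) = \<gamma> \<theta>"
proof (induction k)
  case (Suc k)
  have "\<gamma> (\<theta> + 2 * pi * real (Suc k)) = \<gamma> (\<theta> + 2 * pi * real k + 2 * pi)"
    by (rule arg_cong[where f = \<gamma>]) (simp add: algebra_simps)
  with Suc show ?case
    by (simp add: \<gamma>_add_2pi)
qed simp

lemma \<gamma>_shift:
  assumes "0 \<le> \<eta>" "0 \<le> \<phi>"
  obtains \<psi> where "\<eta> \<le> \<psi>" "\<psi> < \<eta> + 2 * pi" "\<gamma> \<psi> = \<gamma> \<phi>" "cis \<psi> = cis \<phi>"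
proof -
  define k where "k = \<lfloor>(\<phi> - \<eta>) / (2 * pi)\<rfloor>"
  define \<psi> where "\<psi> = \<phi> - 2 * pi * of_int k"
  have "of_int k \<le> (\<phi> - \<eta>) / (2 * pi)" "(\<phi> - \<eta>) / (2 * pi) < of_int k + 1"
    unfolding k_def by linarith+
  then have \<psi>: "\<eta> \<le> \<psi>" "\<psi> < \<eta> + 2 * pi"
    by (simp_all add: \<psi>_def field_simps)
  \<comment> \<open>The number \<open>k\<close> of turns may have either sign, whereas
    \<open>\<gamma>_add_2pi_nat\<close> only adds turns.\<close>
  have "\<gamma> \<psi> = \<gamma> \<phi> \<and> cis \<psi> = cis \<phi>"
  proof (cases "k \<ge> 0")
    case True
    then have "\<phi> = \<psi> + 2 * pi * real (nat k)" by (simp add: \<psi>_def)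
    then show ?thesis
      using \<gamma>_add_2pi_nat cis_add_2pi_nat \<psi> assms by auto
  next
    case False
    then have "\<psi> = \<phi> + 2 * pi * real (nat (- k))" by (simp add: \<psi>_def)
    then show ?thesis
      using \<gamma>_add_2pi_nat cis_add_2pi_nat assms by auto
  qed
  with \<psi> that show thesis by blast
qed

section \<open>Monotonicity and support points of the curve\<close>

text \<open>On a turning run the height over \<open>cis \<eta>\<close> is a constant plus the cosine
  of the angle to \<open>\<eta>\<close>, strictly decreasing during the half-turn after
  \<open>\<eta>\<close>; on a resting run the point does not move.\<close>

lemma \<gamma>_piece_mono:
  assumes "\<alpha> i \<le> s" "s \<le> \<phi>" "\<phi> \<le> \<alpha> (Suc i)" "\<eta> \<le> s" "\<phi> \<le> \<eta> + pi"
  shows "\<gamma> \<phi> \<bullet> cis \<eta> < \<gamma> s \<bullet> cis \<eta> \<or> \<gamma> \<phi> = \<gamma> s"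
proof (cases "even i \<and> s < \<phi>")
  case True
  have "\<gamma> s = U i + cis s" "\<gamma> \<phi> = U i + cis \<phi>"
    using \<gamma>_eq[of i] True assms by auto
  moreover have "cos (\<phi> - \<eta>) < cos (s - \<eta>)"
    using assms True by (intro cos_monotone_0_pi) auto
  ultimately show ?thesis
    by (simp add: inner_add_left)
next
  case False
  then show ?thesis
    using \<gamma>_eq[of i s] \<gamma>_eq[of i \<phi>] assms by (cases "s = \<phi>") auto
qed

text \<open>
  While \<open>\<gamma>\<close> turns, its velocity at \<open>t\<close> is the tangent \<open>\<i> * cis t\<close>, whose inner product with
  \<open>cis \<eta>\<close> is \<open>- sin (t - \<eta>)\<close>.
\<close>

lemma \<gamma>_mono:
  assumes "0 \<le> \<eta>" "\<eta> \<le> s" "s \<le> \<phi>" "\<phi> \<le> \<eta> + pi"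
  shows "\<gamma> \<phi> \<bullet> cis \<eta> < \<gamma> s \<bullet> cis \<eta> \<or> \<gamma> \<phi> = \<gamma> s"
  using assms(2,3)
proof (induction "run \<phi> - run s" arbitrary: s rule: less_induct)
  case less
  show ?case
  proof (cases "\<phi> \<le> \<alpha> (Suc (run s))")
    case True
    then show ?thesis
      using less assms \<alpha>_run_le[of s] by (intro \<gamma>_piece_mono[of "run s"]) auto
  next
    case False
    \<comment> \<open>The end of the run of \<open>s\<close> is the intermediate point; the
      induction counts the runs still ahead.\<close>
    define s' where "s' = \<alpha> (Suc (run s))"
    have "run s' = Suc (run s)" unfolding s'_def by (intro run_eqI) auto
    moreover have "run s < run \<phi>"
      using False less_\<alpha>_run[of \<phi>] \<alpha>_less_iff[of "Suc (run s)" "Suc (run \<phi>)"] by linarith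
    ultimately have "\<gamma> \<phi> \<bullet> cis \<eta> < \<gamma> s' \<bullet> cis \<eta> \<or> \<gamma> \<phi> = \<gamma> s'"
      using less False less_\<alpha>_run[of s] by (intro less.hyps) (auto simp: s'_def)
    moreover have "\<gamma> s' \<bullet> cis \<eta> < \<gamma> s \<bullet> cis \<eta> \<or> \<gamma> s' = \<gamma> s"
      using less assms False \<alpha>_run_le[of s] less_\<alpha>_run[of s]
      by (intro \<gamma>_piece_mono[of "run s"]) (auto simp: s'_def)
    ultimately show ?thesis by auto
  qed
qed

lemma \<gamma>_mono':
  assumes "0 \<le> \<eta>" "\<eta> + pi \<le> s" "s \<le> \<phi>" "\<phi> \<le> \<eta> + 2 * pi"
  shows "\<gamma> s \<bullet> cis \<eta> < \<gamma> \<phi> \<bullet> cis \<eta> \<or> \<gamma> \<phi> = \<gamma> s"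
  using \<gamma>_mono[of "\<eta> + pi" s \<phi>] assms by simp

text \<open>Up to full turns, \<open>\<phi>\<close> lies in the turn that starts at
  \<open>\<eta>\<close>. Along it the height falls for a half-turn and then rises back to its
  initial value.\<close>

lemma \<gamma>_support:
  assumes "0 \<le> \<eta>" "0 \<le> \<phi>"
  shows "\<gamma> \<phi> \<bullet> cis \<eta> < \<gamma> \<eta> \<bullet> cis \<eta> \<or> \<gamma> \<phi> = \<gamma> \<eta>"
proof -
  obtain \<psi> where \<psi>: "\<eta> \<le> \<psi>" "\<psi> < \<eta> + 2 * pi" "\<gamma> \<psi> = \<gamma> \<phi>"
    using \<gamma>_shift assms by metis
  show ?thesis
  proof (cases "\<psi> \<le> \<eta> + pi")
    case True
    then show ?thesis using \<gamma>_mono[of \<eta> \<eta> \<psi>] \<psi> assms by auto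
  next
    case False
    then show ?thesis
      using \<gamma>_mono'[of \<eta> \<psi> "\<eta> + 2 * pi"] \<gamma>_add_2pi[of \<eta>] \<psi> assms by auto
  qed
qed

text \<open>The height over \<open>cis \<theta>\<close> never rises between \<open>\<theta>\<close>
  and \<open>\<phi>\<close>, so equal end points leave no room for a strict drop.\<close>

lemma \<gamma>_rest:
  assumes "0 \<le> \<theta>" "\<theta> \<le> \<psi>" "\<psi> \<le> \<phi>" "\<phi> \<le> \<theta> + pi" "\<gamma> \<theta> = \<gamma> \<phi>"
  shows "\<gamma> \<psi> = \<gamma> \<theta>"
  using \<gamma>_mono[of \<theta> \<theta> \<psi>] \<gamma>_mono[of \<theta> \<psi> \<phi>] assms by auto

section \<open>The body of constant width\<close>

text \<open>As an intersection of half-planes the body is closed and convex at once; that the curve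
  is its whole boundary is \<open>frontier_R\<close>.\<close>

definition R :: "complex set" where
  "R = {x. \<forall>\<theta>\<ge>0. x \<bullet> cis \<theta> \<le> \<gamma> \<theta> \<bullet> cis \<theta>}"

lemma \<gamma>_in_R: "0 \<le> \<theta> \<Longrightarrow> \<gamma> \<theta> \<in> R"
  using \<gamma>_support by (fastforce simp: R_def)

text \<open>The lower bound is the half-plane of the opposite normal, since
  \<open>\<gamma>_add_pi\<close> puts the two parallel support lines at distance 1.\<close>

lemma R_width:
  assumes "x \<in> R" "0 \<le> \<theta>"
  shows "x \<bullet> cis \<theta> \<le> \<gamma> \<theta> \<bullet> cis \<theta>" "\<gamma> \<theta> \<bullet> cis \<theta> - 1 \<le> x \<bullet> cis \<theta>"
proof -
  show "x \<bullet> cis \<theta> \<le> \<gamma> \<theta> \<bullet> cis \<theta>"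
    using assms by (simp add: R_def)
  have "x \<bullet> cis (\<theta> + pi) \<le> \<gamma> (\<theta> + pi) \<bullet> cis (\<theta> + pi)"
    using assms unfolding R_def by (metis (mono_tags, lifting) add_nonneg_nonneg mem_Collect_eq pi_ge_zero)
  then show "\<gamma> \<theta> \<bullet> cis \<theta> - 1 \<le> x \<bullet> cis \<theta>"
    using assms by (simp add: \<gamma>_add_pi inner_diff_left)
qed

text \<open>The distance is the inner product of \<open>x - y\<close> with its own direction, and in
  that direction both points lie in a strip of width 1.\<close>

lemma norm_diff_R:
  assumes "x \<in> R" "y \<in> R"
  shows "norm (x - y) \<le> 1"
proof (cases "x = y")
  case False
  obtain \<theta> where \<theta>: "0 \<le> \<theta>" "sgn (x - y) = cis \<theta>"
    using unit_eq_cis False by (metis norm_sgn right_minus_eq)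
  have "(x - y) \<bullet> sgn (x - y) \<le> 1"
    using R_width[OF assms(1) \<theta>(1)] R_width[OF assms(2) \<theta>(1)] by (simp add: \<theta> inner_diff_left)
  moreover have "(x - y) \<bullet> sgn (x - y) = norm (x - y)"
    using False by (simp add: sgn_div_norm power2_norm_eq_inner[symmetric] power2_eq_square)
  ultimately show ?thesis by simp
qed simp

text \<open>The difference \<open>d = x - \<gamma> \<theta>\<close> is orthogonal to
  \<open>cis \<theta>\<close>, so the squared distance from \<open>x\<close> to the antipodal point
  \<open>\<gamma> (\<theta> + pi)\<close> is \<open>d \<bullet> d + 1\<close>; it is at most
  1.\<close>

lemma support_unique:
  assumes "x \<in> R" "0 \<le> \<theta>" "x \<bullet> cis \<theta> = \<gamma> \<theta> \<bullet> cis \<theta>"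
  shows "x = \<gamma> \<theta>"
proof -
  let ?d = "x - \<gamma> \<theta>"
  have "norm (x - \<gamma> (\<theta> + pi)) \<le> 1"
    using assms by (intro norm_diff_R \<gamma>_in_R) auto
  then have "norm (?d + cis \<theta>) \<le> 1"
    using assms by (simp only: \<gamma>_add_pi) (simp add: algebra_simps)
  then have "(norm (?d + cis \<theta>))\<^sup>2 \<le> 1"
    by (simp add: power_le_one)
  moreover have "?d \<bullet> cis \<theta> = 0"
    using assms by (simp add: inner_diff_left)
  ultimately have "?d \<bullet> ?d \<le> 0"
    by (simp add: power2_norm_eq_inner inner_add_left inner_add_right inner_commute)
  then show ?thesis
    using inner_ge_zero[of ?d] by simp
qed

lemma convex_R: "convex R"
  and closed_R: "closed R"
proof -
  have R: "R = (\<Inter>\<theta>\<in>{0..}. {x. cis \<theta> \<bullet> x \<le> \<gamma> \<theta> \<bullet> cis \<theta>})"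
    by (auto simp: R_def inner_commute)
  show "convex R" "closed R"
    unfolding R by (intro convex_INT closed_INT ballI convex_halfspace_le closed_halfspace_le)+
qed

lemma compact_R: "compact R"
proof -
  have "bounded R"
    using norm_diff_R[of _ "\<gamma> 0"] \<gamma>_in_R[of 0] by (intro boundedI[of _ "1 + norm (\<gamma> 0)"])
      (smt (verit) norm_triangle_ineq2)
  then show ?thesis
    using closed_R by (simp add: compact_eq_bounded_closed)
qed

lemma diameter_eq_1:
  assumes "S \<subseteq> R" "\<gamma> 0 \<in> S" "\<gamma> pi \<in> S"
  shows "diameter S = 1"
proof (rule antisym)
  show "diameter S \<le> 1"
    using assms norm_diff_R by (intro diameter_le) auto
  have "bounded S"
    using compact_R assms compact_imp_bounded bounded_subset by blast
  then have "dist (\<gamma> 0) (\<gamma> pi) \<le> diameter S"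
    using assms by (intro diameter_bounded_bound)
  then show "1 \<le> diameter S"
    using \<gamma>_add_pi[of 0] by (simp add: dist_norm)
qed

lemma constant_width_R: "constant_width R"
  unfolding constant_width_def
proof (intro exI allI impI)
  fix u :: complex
  assume "norm u = 1"
  then obtain \<theta> where \<theta>: "0 \<le> \<theta>" "u = cis \<theta>" by (rule unit_eq_cis)
  have "(SUP x\<in>R. x \<bullet> u) = \<gamma> \<theta> \<bullet> u"
    using \<theta> \<gamma>_in_R by (intro cSup_eq_maximum) (auto simp: R_def)
  moreover have "(INF x\<in>R. x \<bullet> u) = \<gamma> (\<theta> + pi) \<bullet> u"
  proof (intro cInf_eq_minimum)
    fix y assume "y \<in> (\<lambda>x. x \<bullet> u) ` R"
    then obtain x where "x \<in> R" "y = x \<bullet> u" by auto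
    then show "\<gamma> (\<theta> + pi) \<bullet> u \<le> y"
      using \<theta> R_width(2)[of x \<theta>] by (simp add: \<gamma>_add_pi inner_diff_left)
  qed (use \<theta> \<gamma>_in_R in auto)
  ultimately show "(SUP x\<in>R. x \<bullet> u) - (INF x\<in>R. x \<bullet> u) = 1"
    using \<theta> by (simp add: \<gamma>_add_pi inner_diff_left)
qed

text \<open>A boundary point has a supporting line, whose normal singles it out by
  \<open>support_unique\<close>. Conversely, moving a point of the curve outward along its normal
  leaves \<open>R\<close>.\<close>

lemma frontier_R: "frontier R = \<gamma> ` {0..}"
proof (intro equalityI subsetI)
  fix x assume x: "x \<in> frontier R"
  then have xR: "x \<in> R"
    using closed_R frontier_subset_closed by blast
  \<comment> \<open>That the interior is nonempty comes only later, from the inscribed polygon. If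
    it is empty, a line containing \<open>R\<close> serves as the supporting line.\<close>
  have "x \<notin> rel_interior R \<or> interior R = {}"
    using x by (metis DiffD2 frontier_def interior_rel_interior_gen)
  then obtain a where a: "a \<noteq> 0" "\<And>y. y \<in> R \<Longrightarrow> y \<bullet> a \<le> x \<bullet> a"
  proof
    assume "x \<notin> rel_interior R"
    then obtain a where "\<And>y. y \<in> R \<Longrightarrow> a \<bullet> x \<le> a \<bullet> y" "a \<noteq> 0"
      using supporting_hyperplane_rel_boundary[OF convex_R xR] by metis
    then show thesis by (intro that[of "- a"]) (auto simp: inner_commute)
  next
    assume "interior R = {}"
    then obtain a b where "a \<noteq> 0" "R \<subseteq> {x. a \<bullet> x = b}"
      using empty_interior_subset_hyperplane[OF convex_R] by metis
    then show thesis using xR by (intro that[of a]) (auto simp: inner_commute[of a] subset_iff)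
  qed
  obtain \<theta> where \<theta>: "0 \<le> \<theta>" "sgn a = cis \<theta>"
    using unit_eq_cis a by (metis norm_sgn)
  have "\<gamma> \<theta> \<bullet> sgn a \<le> x \<bullet> sgn a"
    using a \<gamma>_in_R[OF \<theta>(1)] by (simp add: sgn_div_norm)
  then have "x \<bullet> cis \<theta> = \<gamma> \<theta> \<bullet> cis \<theta>"
    using \<theta> xR by (intro antisym) (auto simp: R_def)
  then show "x \<in> \<gamma> ` {0..}"
    using support_unique[OF xR] \<theta> by auto
next
  fix x assume "x \<in> \<gamma> ` {0..}"
  then obtain \<theta> where \<theta>: "0 \<le> \<theta>" "x = \<gamma> \<theta>" by auto
  have "x \<notin> interior R"
  proof
    assume "x \<in> interior R"
    then obtain e where e: "e > 0" "cball x e \<subseteq> R"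
      by (meson mem_interior_cball)
    have "x + e *\<^sub>R cis \<theta> \<in> R"
      using e by (intro subsetD[OF e(2)]) (simp add: dist_norm)
    then have "(x + e *\<^sub>R cis \<theta>) \<bullet> cis \<theta> \<le> \<gamma> \<theta> \<bullet> cis \<theta>"
      using \<theta> by (simp add: R_def)
    then show False
      using e \<theta> by (simp add: inner_add_left)
  qed
  then show "x \<in> frontier R"
    using \<gamma>_in_R[OF \<theta>(1)] \<theta> closed_R by (simp add: frontier_def)
qed

section \<open>Coincidences between points of the curve\<close>

lemma run_add_m:
  assumes "0 \<le> \<theta>"
  shows "run (\<theta> + pi) = run \<theta> + m"
proof (rule run_eqI)
  show "\<alpha> (run \<theta> + m) \<le> \<theta> + pi"
    using \<alpha>_run_le[OF assms] by (simp add: \<alpha>_add)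
  show "\<theta> + pi < \<alpha> (Suc (run \<theta> + m))"
    using less_\<alpha>_run[of \<theta>] \<alpha>_add[of "Suc (run \<theta>)"] by simp
qed

lemma \<alpha>_Suc_less: "\<alpha> (Suc i) < \<alpha> i + pi"
proof -
  have "\<alpha> (Suc i) < \<alpha> (i + m)"
    using m_ge_3 by (subst \<alpha>_less_iff) simp
  then show ?thesis by (simp add: \<alpha>_add)
qed

lemma \<alpha>_add_2m: "\<alpha> (i + 2 * m) = \<alpha> i + 2 * pi"
proof -
  have "i + 2 * m = i + m + m" by simp
  then show ?thesis by (simp only: \<alpha>_add)
qed

lemma cis_neq:
  assumes "s < t" "t < s + pi"
  shows "cis s \<noteq> cis t"
proof
  assume "cis s = cis t"
  then have "cos (t - s) = 1"
    using inner_cis[of t s] inner_cis[of t t] by simp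
  moreover have "cos (t - s) < cos 0"
    using assms by (intro cos_monotone_0_pi) auto
  ultimately show False by simp
qed

lemma turning_neq:
  assumes "even i" "\<alpha> i \<le> s" "s < t" "t \<le> \<alpha> (Suc i)"
  shows "\<gamma> s \<noteq> \<gamma> t"
proof -
  have "\<gamma> s = U i + cis s" "\<gamma> t = U i + cis t"
    using assms \<gamma>_eq[of i] by auto
  moreover have "cis s \<noteq> cis t"
    using assms \<alpha>_Suc_less[of i] by (intro cis_neq) auto
  ultimately show ?thesis by simp
qed

text \<open>One of the two parameter intervals between the points is at most a half-turn long, and
  there \<open>\<gamma>_rest\<close> makes the curve stand still.\<close>

lemma \<gamma>_eq_cases:
  assumes "0 \<le> \<theta>" "\<theta> \<le> \<phi>" "\<phi> \<le> \<theta> + 2 * pi" "\<gamma> \<theta> = \<gamma> \<phi>"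
  shows "(\<forall>\<psi>\<in>{\<theta>..\<phi>}. \<gamma> \<psi> = \<gamma> \<theta>) \<or> (\<forall>\<psi>\<in>{\<phi>..\<theta> + 2 * pi}. \<gamma> \<psi> = \<gamma> \<theta>)"
proof (cases "\<phi> \<le> \<theta> + pi")
  case True
  then have "\<gamma> \<psi> = \<gamma> \<theta>" if "\<psi> \<in> {\<theta>..\<phi>}" for \<psi>
    using that assms by (intro \<gamma>_rest[of \<theta> \<psi> \<phi>]) simp_all
  then show ?thesis by blast
next
  case False
  then have "\<gamma> \<psi> = \<gamma> \<phi>" if "\<psi> \<in> {\<phi>..\<theta> + 2 * pi}" for \<psi>
    using that assms \<gamma>_add_2pi[of \<theta>] by (intro \<gamma>_rest[of \<phi> \<psi> "\<theta> + 2 * pi"]) simp_all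
  then show ?thesis unfolding assms(4) by blast
qed

text \<open>Inside a turning run the curve moves on both sides of \<open>\<theta>\<close>, so a
  second parameter within the turn contradicts both alternatives of
  \<open>\<gamma>_eq_cases\<close>.\<close>

lemma turning_inj:
  assumes "even i" "\<alpha> i < \<theta>" "\<theta> < \<alpha> (Suc i)" "0 \<le> \<phi>" "\<gamma> \<phi> = \<gamma> \<theta>"
  shows "cis \<phi> = cis \<theta>"
proof -
  have \<theta>: "0 \<le> \<theta>" using assms(2) \<alpha>_ge_0[of i] by linarith
  obtain \<psi> where \<psi>: "\<theta> \<le> \<psi>" "\<psi> < \<theta> + 2 * pi" "\<gamma> \<psi> = \<gamma> \<theta>" "cis \<psi> = cis \<phi>"
    using \<gamma>_shift[OF \<theta> assms(4)] assms(5) by metis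
  have "\<psi> = \<theta>"
  proof (rule ccontr)
    assume "\<psi> \<noteq> \<theta>"
    have "(\<forall>\<xi>\<in>{\<theta>..\<psi>}. \<gamma> \<xi> = \<gamma> \<theta>) \<or> (\<forall>\<xi>\<in>{\<psi>..\<theta> + 2 * pi}. \<gamma> \<xi> = \<gamma> \<theta>)"
      using \<theta> \<psi> by (intro \<gamma>_eq_cases) simp_all
    then show False
    proof
      assume 1: "\<forall>\<xi>\<in>{\<theta>..\<psi>}. \<gamma> \<xi> = \<gamma> \<theta>"
      define t where "t = min \<psi> (\<alpha> (Suc i))"
      have t: "\<theta> < t" "t \<le> \<psi>" "t \<le> \<alpha> (Suc i)"
        using \<psi>(1) \<open>\<psi> \<noteq> \<theta>\<close> assms(3) by (auto simp: t_def)
      then have "\<gamma> t = \<gamma> \<theta>"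
        by (intro bspec[OF 1]) auto
      then show False
        using turning_neq[of i \<theta> t] assms(1,2) t by simp
    next
      assume 2: "\<forall>\<xi>\<in>{\<psi>..\<theta> + 2 * pi}. \<gamma> \<xi> = \<gamma> \<theta>"
      \<comment> \<open>One full turn later, run \<open>i\<close> reappears as run
        \<open>i + 2 * m\<close>; the maximum keeps \<open>t\<close> inside it.\<close>
      define t where "t = max \<psi> (\<alpha> (i + 2 * m))"
      have t: "\<psi> \<le> t" "\<alpha> (i + 2 * m) \<le> t" "t < \<theta> + 2 * pi"
        using \<psi> assms by (auto simp: t_def \<alpha>_add_2m)
      have "\<gamma> t \<noteq> \<gamma> (\<theta> + 2 * pi)"
        using assms t \<alpha>_add_2m[of "Suc i"] by (intro turning_neq[of "i + 2 * m"]) auto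
      moreover have "\<gamma> t = \<gamma> \<theta>"
        using t by (intro bspec[OF 2]) auto
      ultimately show False
        using \<gamma>_add_2pi[OF \<theta>] by simp
    qed
  qed
  then show ?thesis using \<psi> by simp
qed

lemma periodic_mod:
  assumes "\<And>i. f (i + m) = f i"
  shows "f (i mod m) = f i"
proof -
  have "f (j + k * m) = f j" for j k
    by (induction k) (simp_all add: assms add.assoc[symmetric] add.commute[of m])
  from this[of "i mod m" "i div m"] show ?thesis by simp
qed

lemma U_mod [simp]: "U (i mod m) = U i"
  by (rule periodic_mod) (rule U_add)

text \<open>A turning run starts where the preceding run rests. The index \<open>i + m - 1\<close>
  replaces \<open>i - 1\<close>, which would fail for \<open>i = 0\<close>; the proof takes the
  preceding run one full turn later.\<close>

lemma \<gamma>_\<alpha>: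
  assumes "even i"
  shows "\<gamma> (\<alpha> i) = U (i + m - 1)"
proof -
  define j where "j = i + 2 * m - 1"
  have j: "Suc j = i + 2 * m" "odd j" "j = i + m - 1 + m"
    using m_ge_3 assms by (auto simp: j_def)
  have "\<gamma> (\<alpha> i) = \<gamma> (\<alpha> (Suc j))"
    unfolding j(1) \<alpha>_add_2m by (simp add: \<gamma>_add_2pi)
  also have "\<dots> = U j"
    using j(2) by (simp only: \<gamma>_\<alpha>_Suc) simp
  also have "\<dots> = U (i + m - 1)"
    by (simp only: j(3) U_add)
  finally show ?thesis .
qed

text \<open>A full turn has \<open>2 * m\<close> runs, and up to full turns the vertex
  \<open>U i\<close> owns the runs \<open>i\<close> and \<open>i + m\<close>, of opposite parity.
  This function and \<open>turning\<close> select the one that rests at the vertex and the one that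
  turns around it.\<close>

definition resting :: "nat \<Rightarrow> nat" where
  "resting i = (if odd i then i else i + m)"

definition turning :: "nat \<Rightarrow> nat" where
  "turning i = (if even i then i else i + m)"

lemma odd_resting: "odd (resting i)" and U_resting: "U (resting i) = U i"
  and even_turning: "even (turning i)" and U_turning: "U (turning i) = U i"
  using odd_m by (auto simp: resting_def turning_def U_add)

lemma \<gamma>_resting: "\<theta> \<in> {\<alpha> (resting i)..\<alpha> (Suc (resting i))} \<Longrightarrow> \<gamma> \<theta> = U i"
  using \<gamma>_eq[of "resting i" \<theta>] odd_resting[of i] U_resting[of i] by simp

lemma \<gamma>_turning: "\<theta> \<in> {\<alpha> (turning i)..\<alpha> (Suc (turning i))} \<Longrightarrow> \<gamma> \<theta> = U i + cis \<theta>"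
  using \<gamma>_eq[of "turning i" \<theta>] even_turning[of i] U_turning[of i] by simp

text \<open>Between two different resting runs there are turning runs on both sides.\<close>

lemma U_neq_odd:
  assumes "odd a" "odd b" "a < b" "b < 2 * m"
  shows "U a \<noteq> U b"
proof
  assume eq: "U a = U b"
  have ab: "Suc a < b"
    using assms by (metis Suc_lessI even_Suc)
  have ba: "Suc b < a + 2 * m"
  proof -
    have "Suc b \<noteq> a + 2 * m" using assms by (metis even_Suc even_add even_mult_iff even_numeral)
    then show ?thesis using assms by linarith
  qed
  have \<gamma>: "\<gamma> (\<alpha> (Suc a)) = U a" "\<gamma> (\<alpha> b) = U b" "\<gamma> (\<alpha> (Suc b)) = U b"
    using \<gamma>_eq[of b "\<alpha> b"] assms by (simp_all add: \<gamma>_\<alpha>_Suc)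
  have "\<alpha> b \<le> \<alpha> (Suc a) + 2 * pi"
    using assms by (subst \<alpha>_add_2m[symmetric]) (subst \<alpha>_le_iff, simp)
  then have "(\<forall>\<psi>\<in>{\<alpha> (Suc a)..\<alpha> b}. \<gamma> \<psi> = \<gamma> (\<alpha> (Suc a)))
    \<or> (\<forall>\<psi>\<in>{\<alpha> b..\<alpha> (Suc a) + 2 * pi}. \<gamma> \<psi> = \<gamma> (\<alpha> (Suc a)))"
    using ab by (intro \<gamma>_eq_cases) (simp_all only: \<gamma> eq \<alpha>_ge_0 \<alpha>_le_iff less_imp_le)
  then show False
  proof
    assume 1: "\<forall>\<psi>\<in>{\<alpha> (Suc a)..\<alpha> b}. \<gamma> \<psi> = \<gamma> (\<alpha> (Suc a))"
    have "\<gamma> (\<alpha> (Suc (Suc a))) = \<gamma> (\<alpha> (Suc a))"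
      using ab by (intro bspec[OF 1]) simp
    then show False
      using turning_neq[of "Suc a" "\<alpha> (Suc a)" "\<alpha> (Suc (Suc a))"] assms by auto
  next
    assume 2: "\<forall>\<psi>\<in>{\<alpha> b..\<alpha> (Suc a) + 2 * pi}. \<gamma> \<psi> = \<gamma> (\<alpha> (Suc a))"
    have in1: "\<alpha> (Suc b) \<in> {\<alpha> b..\<alpha> (Suc a) + 2 * pi}" "\<alpha> (Suc (Suc b)) \<in> {\<alpha> b..\<alpha> (Suc a) + 2 * pi}"
      using ba by (simp_all only: \<alpha>_add_2m[symmetric] atLeastAtMost_iff \<alpha>_le_iff) auto
    have "\<gamma> (\<alpha> (Suc (Suc b))) = \<gamma> (\<alpha> (Suc b))"
      using bspec[OF 2 in1(1)] bspec[OF 2 in1(2)] by simp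
    then show False
      using turning_neq[of "Suc b" "\<alpha> (Suc b)" "\<alpha> (Suc (Suc b))"] assms by auto
  qed
qed

text \<open>\<open>resting\<close> moves the indices injectively to odd ones below
  \<open>2 * m\<close> with the same vertices, where \<open>U_neq_odd\<close> applies.\<close>

lemma inj_U: "inj_on U {..<m}"
proof (rule inj_onI)
  fix i j assume ij: "i \<in> {..<m}" "j \<in> {..<m}" "U i = U j"
  have less: "resting i < 2 * m" "resting j < 2 * m"
    using ij by (auto simp: resting_def)
  have "\<not> resting i < resting j" "\<not> resting j < resting i"
    using U_neq_odd[OF odd_resting odd_resting _ less(2), of i]
      U_neq_odd[OF odd_resting odd_resting _ less(1), of j] ij(3) by (auto simp: U_resting)
  then have "resting i = resting j" by simp
  then show "i = j"
    using ij by (auto simp: resting_def split: if_splits)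
qed

section \<open>The star polygon\<close>

lemma dist_U_Suc: "dist (U i) (U (Suc i)) = 1"
  by (simp add: U_Suc' dist_norm norm_mult norm_power)

text \<open>A difference of norm 1 uses the full width in its own direction, so both points are the
  support points there.\<close>

lemma diametral_pair:
  assumes "x \<in> R" "y \<in> R" "dist x y = 1"
  obtains \<theta> where "0 \<le> \<theta>" "x = \<gamma> \<theta>" "y = \<gamma> (\<theta> + pi)" "x - y = cis \<theta>"
proof -
  obtain \<theta> where \<theta>: "0 \<le> \<theta>" "x - y = cis \<theta>"
    using unit_eq_cis assms by (metis dist_norm)
  have "(x - y) \<bullet> cis \<theta> = 1"
    by (simp add: \<theta>)
  then have "x \<bullet> cis \<theta> = \<gamma> \<theta> \<bullet> cis \<theta>"
    using R_width[OF assms(1) \<theta>(1)] R_width[OF assms(2) \<theta>(1)] by (simp add: inner_diff_left)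
  then have x: "x = \<gamma> \<theta>"
    using support_unique assms \<theta> by blast
  moreover have "y = x - cis \<theta>"
    using \<theta> by (simp add: algebra_simps)
  ultimately show thesis
    using \<theta> that by (simp add: \<gamma>_add_pi)
qed

text \<open>The resting run gives a vertex a whole interval of normals. Two of them already keep it
  out of the interior of every turning run.\<close>

lemma U_eq_\<gamma>:
  obtains \<theta> \<phi> where "0 \<le> \<theta>" "0 \<le> \<phi>" "U i = \<gamma> \<theta>" "U i = \<gamma> \<phi>" "cis \<theta> \<noteq> cis \<phi>"
proof -
  let ?r = "resting i"
  have "U i = \<gamma> (\<alpha> ?r)" "U i = \<gamma> (\<alpha> (Suc ?r))"
    by (rule \<gamma>_resting[symmetric], simp)+
  moreover have "cis (\<alpha> ?r) \<noteq> cis (\<alpha> (Suc ?r))"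
    using \<alpha>_Suc_less[of ?r] by (intro cis_neq) auto
  ultimately show thesis by (intro that) auto
qed

lemma U_in_R: "U i \<in> R"
  using U_eq_\<gamma>[of i] \<gamma>_in_R by metis

lemma U_not_inside_turning:
  assumes "even i" "\<alpha> i < \<theta>" "\<theta> < \<alpha> (Suc i)"
  shows "\<gamma> \<theta> \<noteq> U j"
  using U_eq_\<gamma>[of j] turning_inj[OF assms] by metis

lemma turning_end:
  assumes "even i" "\<alpha> i \<le> \<theta>" "\<theta> \<le> \<alpha> (Suc i)" "\<not> (\<alpha> i < \<theta> \<and> \<theta> < \<alpha> (Suc i))"
  shows "\<gamma> \<theta> \<in> {U (i + m - 1), U (Suc i)}"
proof -
  have "\<theta> = \<alpha> i \<or> \<theta> = \<alpha> (Suc i)" using assms by linarith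
  then show ?thesis using assms(1) \<gamma>_\<alpha> \<gamma>_\<alpha>_Suc by auto
qed

text \<open>The point \<open>U j\<close> is reached while turning around \<open>U k\<close>. A
  vertex can occur only at an end of a turning run, and these ends are the neighbours of its
  centre.\<close>

lemma star_pair_aux:
  assumes "U j - U k = cis \<theta>" "0 \<le> \<theta>" "even (run \<theta>)"
    and "U j = \<gamma> \<theta>"
  shows "\<exists>i. {U j, U k} = {U i, U (Suc i)}"
proof -
  let ?i = "run \<theta>"
  have "U j = U ?i + cis \<theta>"
    using assms by (simp add: \<gamma>_def)
  with assms(1) have k: "U k = U ?i"
    by (metis add_diff_cancel_right' diff_add_cancel add.commute)
  have "\<gamma> \<theta> \<in> {U (?i + m - 1), U (Suc ?i)}"
  proof (rule turning_end)
    show "\<not> (\<alpha> ?i < \<theta> \<and> \<theta> < \<alpha> (Suc ?i))"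
      using U_not_inside_turning[OF assms(3)] assms(4) by metis
  qed (use assms(2,3) less_\<alpha>_run[of \<theta>] \<alpha>_run_le in auto)
  then consider "U j = U (?i + m - 1)" | "U j = U (Suc ?i)"
    using assms by auto
  then show ?thesis
  proof cases
    case 1
    moreover have "U k = U (Suc (?i + m - 1))"
      using k m_ge_3 U_add[of ?i] by simp
    ultimately show ?thesis by metis
  next
    case 2
    then show ?thesis using k by (metis insert_commute)
  qed
qed

text \<open>Of the opposite parameters \<open>\<theta>\<close> and \<open>\<theta> + pi\<close>,
  exactly one lies in a turning run.\<close>

lemma star_pair:
  assumes "dist (U j) (U k) = 1"
  shows "\<exists>i<m. {U j, U k} = {U i, U (Suc i mod m)}"
proof -
  obtain \<theta> where \<theta>: "0 \<le> \<theta>" "U j = \<gamma> \<theta>" "U k = \<gamma> (\<theta> + pi)" "U j - U k = cis \<theta>"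
    using diametral_pair[OF U_in_R U_in_R assms] by metis
  have "\<exists>i. {U j, U k} = {U i, U (Suc i)}"
  proof (cases "even (run \<theta>)")
    case True
    then show ?thesis using star_pair_aux \<theta> by blast
  next
    case False
    then have "even (run (\<theta> + pi))"
      using odd_m \<theta> by (simp add: run_add_m)
    moreover have "U k - U j = cis (\<theta> + pi)"
      unfolding cis_add_pi \<theta>(4)[symmetric] by simp
    ultimately show ?thesis
      using star_pair_aux[of k j "\<theta> + pi"] \<theta> by (simp add: insert_commute)
  qed
  then obtain i where "{U j, U k} = {U i, U (Suc i)}" by auto
  then have "{U j, U k} = {U (i mod m), U (Suc (i mod m) mod m)}"
    by (simp add: mod_Suc_eq)
  then show ?thesis
    using m_ge_3 by (intro exI[of _ "i mod m"]) simp
qed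

text \<open>The lines cross at parameters \<open>s\<close>, \<open>t\<close> with
  \<open>d = t *\<^sub>R cis \<phi> - s *\<^sub>R cis \<theta>\<close>. Testing the ends of each
  chord against the support strip of the other confines both parameters to the unit interval.
  Parallel chords coincide.\<close>

lemma chords_meet_aux:
  assumes "0 \<le> \<theta>" "0 \<le> \<phi>" "cos (\<phi> - \<theta>) \<ge> 0"
  shows "closed_segment (\<gamma> \<theta>) (\<gamma> (\<theta> + pi)) \<inter> closed_segment (\<gamma> \<phi>) (\<gamma> (\<phi> + pi)) \<noteq> {}"
proof (cases "sin (\<phi> - \<theta>) = 0")
  case True
  then have "(cos (\<phi> - \<theta>))\<^sup>2 = 1"
    using sin_cos_squared_add[of "\<phi> - \<theta>"] by simp
  then have "cos (\<phi> - \<theta>) = 1"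
    using assms by (simp add: power2_eq_1_iff)
  then have "cis (\<phi> - \<theta>) = 1"
    using True by (simp add: complex_eq_iff)
  then have "cis \<phi> = cis \<theta>"
    using cis_mult[of "\<phi> - \<theta>" \<theta>] by simp
  then have "\<gamma> \<phi> = \<gamma> \<theta>"
    using \<gamma>_support[of \<theta> \<phi>] \<gamma>_support[of \<phi> \<theta>] assms by auto
  then show ?thesis by auto
next
  case False
  define S where "S = sin (\<phi> - \<theta>)"
  define c where "c = cos (\<phi> - \<theta>)"
  define d where "d = \<gamma> \<phi> - \<gamma> \<theta>"
  \<comment> \<open>Cramer's rule for the crossing point, with determinant \<open>S\<close>.\<close>
  define t where "t = (Im d * cos \<theta> - Re d * sin \<theta>) / S"
  define s where "s = (Im d * cos \<phi> - Re d * sin \<phi>) / S"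
  have S: "S \<noteq> 0" "S = sin \<phi> * cos \<theta> - cos \<phi> * sin \<theta>"
    using False by (simp_all add: S_def sin_diff)
  have d: "d = t *\<^sub>R cis \<phi> - s *\<^sub>R cis \<theta>"
  proof (rule complex_eqI)
    have "S * (t * cos \<phi> - s * cos \<theta>) = S * Re d" "S * (t * sin \<phi> - s * sin \<theta>) = S * Im d"
      using S(1) by (simp_all add: t_def s_def right_diff_distrib) (simp_all add: S(2) algebra_simps)
    then show "Re d = Re (t *\<^sub>R cis \<phi> - s *\<^sub>R cis \<theta>)" "Im d = Im (t *\<^sub>R cis \<phi> - s *\<^sub>R cis \<theta>)"
      using S(1) by simp_all
  qed
  have c': "cos (\<theta> - \<phi>) = c"
    using cos_minus[of "\<phi> - \<theta>"] by (simp add: c_def)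
  have d\<theta>: "d \<bullet> cis \<theta> = t * c - s" and d\<phi>: "d \<bullet> cis \<phi> = t - s * c"
    using c' by (simp_all add: d inner_diff_left c_def)
  have b: "\<gamma> \<phi> = \<gamma> \<theta> + d" by (simp add: d_def)
  have R: "\<gamma> \<theta> \<in> R" "\<gamma> \<phi> \<in> R" "\<gamma> (\<theta> + pi) \<in> R" "\<gamma> (\<phi> + pi) \<in> R"
    using assms by (intro \<gamma>_in_R; simp)+
  have 1: "t * c \<le> s"
    using R_width[OF R(2) assms(1)] assms d\<theta> by (simp add: b inner_add_left)
  have 2: "s * c \<le> t"
    using R_width[OF R(1) assms(2)] assms d\<phi> by (simp add: b inner_add_left)
  have 3: "(1 - t) * c \<le> 1 - s"
    using R_width[OF R(4) assms(1)] assms d\<theta>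
    unfolding \<gamma>_add_pi[OF assms(2)]
    by (simp add: b inner_add_left inner_diff_left c_def[symmetric] algebra_simps)
  have 4: "(1 - s) * c \<le> 1 - t"
    using R_width[OF R(3) assms(2)] assms d\<phi> c'
    unfolding \<gamma>_add_pi[OF assms(1)]
    by (simp add: b inner_add_left inner_diff_left algebra_simps)
  have c: "0 \<le> c" "c * c < 1"
  proof -
    show "0 \<le> c" using assms by (simp add: c_def)
    have "c * c = 1 - S\<^sup>2"
      using sin_cos_squared_add[of "\<phi> - \<theta>"] by (simp add: c_def S_def power2_eq_square algebra_simps)
    then show "c * c < 1" using S(1) by simp
  qed
  \<comment> \<open>Combining the inequalities gives \<open>y * c * c \<le> y\<close>, and
    \<open>c * c < 1\<close>. This applies to the pair \<open>s\<close>, \<open>t\<close> and to the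
    pair \<open>1 - s\<close>, \<open>1 - t\<close>.\<close>
  have pos: "0 \<le> y" if "x * c \<le> y" "y * c \<le> x" for x y :: real
  proof -
    have "y * (c * c) \<le> x * c"
      using mult_right_mono[OF that(2) c(1)] by (simp add: algebra_simps)
    then have "0 \<le> y * (1 - c * c)"
      using that(1) by (simp add: algebra_simps)
    then show ?thesis
      using c(2) by (simp add: zero_le_mult_iff)
  qed
  have st: "0 \<le> s" "0 \<le> t" "0 \<le> 1 - s" "0 \<le> 1 - t"
    using pos 1 2 3 4 by blast+
  define x where "x = \<gamma> \<theta> - s *\<^sub>R cis \<theta>"
  have "x = \<gamma> \<phi> - t *\<^sub>R cis \<phi>"
    by (simp add: x_def b d)
  then have "x \<in> closed_segment (\<gamma> \<phi>) (\<gamma> (\<phi> + pi))"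
    unfolding \<gamma>_add_pi[OF assms(2)] using st by (simp only: diff_scaleR_in_segment)
  moreover have "x \<in> closed_segment (\<gamma> \<theta>) (\<gamma> (\<theta> + pi))"
    unfolding \<gamma>_add_pi[OF assms(1)] x_def using st by (simp only: diff_scaleR_in_segment)
  ultimately show ?thesis by blast
qed

text \<open>Replacing \<open>\<phi>\<close> by \<open>\<phi> + pi\<close> swaps the ends of the
  second chord and flips the sign of the cosine.\<close>

lemma chords_meet:
  assumes "0 \<le> \<theta>" "0 \<le> \<phi>"
  shows "closed_segment (\<gamma> \<theta>) (\<gamma> (\<theta> + pi)) \<inter> closed_segment (\<gamma> \<phi>) (\<gamma> (\<phi> + pi)) \<noteq> {}"
proof (cases "cos (\<phi> - \<theta>) \<ge> 0")
  case False
  have "\<gamma> (\<phi> + pi + pi) = \<gamma> \<phi>"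
    using assms by (subst \<gamma>_add_pi) (simp_all add: \<gamma>_add_pi)
  moreover have "cos (\<phi> + pi - \<theta>) \<ge> 0"
    using False cos_periodic_pi[of "\<phi> - \<theta>"] by (simp add: algebra_simps)
  ultimately show ?thesis
    using chords_meet_aux[of \<theta> "\<phi> + pi"] assms by (simp add: closed_segment_commute)
qed (rule chords_meet_aux[OF assms])

lemma side_chord:
  "convex hull {U i, U (Suc i)} = closed_segment (\<gamma> (\<alpha> (Suc i))) (\<gamma> (\<alpha> (Suc i) + pi))"
proof -
  have "{U i, U (Suc i)} = {\<gamma> (\<alpha> (Suc i)), \<gamma> (\<alpha> (Suc i) + pi)}"
    by (auto simp: \<gamma>_add_pi \<gamma>_\<alpha>_Suc U_Suc')
  then show ?thesis by (simp add: segment_convex_hull)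
qed

lemma star_polygon_U: "star_polygon (U ` {..<m}) 1 (map U [0..<m])"
proof -
  define vs where "vs = map U [0..<m]"
  have len: "length vs = m"
    by (simp add: vs_def)
  have side: "{vs ! i, vs ! (Suc i mod m)} = {U i, U (Suc i)}" if "i < m" for i
    using that m_ge_3 by (simp add: vs_def)
  have "{{x, y} | x y. x \<in> U ` {..<m} \<and> y \<in> U ` {..<m} \<and> dist x y = 1} = {{U i, U (Suc i)} | i. i < m}"
    (is "?A = ?B")
  proof (intro equalityI subsetI)
    fix e assume "e \<in> ?A"
    then obtain j k where "e = {U j, U k}" "dist (U j) (U k) = 1" by auto
    then show "e \<in> ?B" using star_pair[of j k] by auto
  next
    fix e assume "e \<in> ?B"
    then obtain i where i: "i < m" "e = {U i, U (Suc i)}" by auto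
    have "U (Suc i) \<in> U ` {..<m}"
      using m_ge_3 U_mod[of "Suc i"] by (intro image_eqI[of _ _ "Suc i mod m"]) auto
    then show "e \<in> ?A"
      using i dist_U_Suc[of i] by blast
  qed
  also have "?B = {{vs ! i, vs ! (Suc i mod m)} | i. i < m}"
    by (rule Collect_cong) (metis side)
  finally have pairs: "?A = {{vs ! i, vs ! (Suc i mod m)} | i. i < m}" .
  have "convex hull {U i, U (Suc i)} \<inter> convex hull {U j, U (Suc j)} \<noteq> {}" for i j
    unfolding side_chord by (intro chords_meet) simp_all
  moreover have "distinct vs" "set vs = U ` {..<m}"
    using inj_U by (auto simp: vs_def distinct_map lessThan_atLeast0)
  moreover note odd_m
  ultimately show ?thesis
    unfolding star_polygon_def Let_def vs_def[symmetric] len pairs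
    by (intro conjI allI impI) (simp_all only: side refl not_False_eq_True)
qed

text \<open>The sides at \<open>U i\<close> point along \<open>cis (\<alpha> i)\<close> and
  \<open>cis (\<alpha> (Suc i))\<close> with a common sign, which cancels in the inner product.
  Their angle is below \<open>pi\<close>, so \<open>arccos\<close> recovers it.\<close>

lemma star_angle:
  assumes "i < m"
  shows "angle_at (map U [0..<m] ! i) (map U [0..<m] ! ((i + m - 1) mod m)) (map U [0..<m] ! (Suc i mod m))
    = real (K (Suc i) - K i) * pi / real n"
proof -
  have prev: "U (i + m - 1) - U i = (-1) ^ i * cis (\<alpha> i)"
  proof -
    have "U (Suc (i + m - 1)) = U (i + m - 1) + (-1) ^ (i + m - 1) * cis (\<alpha> (Suc (i + m - 1)))"
      by (rule U_Suc')
    moreover have "Suc (i + m - 1) = i + m" "even (i + m - 1) \<longleftrightarrow> even i"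
      using m_ge_3 odd_m by auto
    ultimately show ?thesis
      by (simp add: U_add \<alpha>_add minus_one_power_iff)
  qed
  have "angle_at (U i) (U (i + m - 1)) (U (Suc i)) = arccos (cos (\<alpha> (Suc i) - \<alpha> i))"
    unfolding angle_at_def prev using cos_minus[of "\<alpha> (Suc i) - \<alpha> i"]
    by (simp add: U_Suc' norm_mult norm_power minus_one_power_iff)
  also have "\<dots> = \<alpha> (Suc i) - \<alpha> i"
    using \<alpha>_less_Suc[of i] \<alpha>_Suc_less[of i] by (intro arccos_cos) auto
  also have "\<dots> = real (K (Suc i) - K i) * pi / real n"
    using K_less_Suc[of i] by (simp add: \<alpha>_def of_nat_diff diff_divide_distrib[symmetric] algebra_simps)
  finally show ?thesis
    using assms m_ge_3 by simp
qed

section \<open>The boundary arcs, each centred at the opposite vertex\<close>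

definition star_arc :: "nat \<Rightarrow> complex set" where
  "star_arc i = path_image (part_circlepath (U i) 1 (\<alpha> (turning i)) (\<alpha> (Suc (turning i))))"

lemma star_arc_eq: "star_arc i = (\<lambda>\<theta>. U i + cis \<theta>) ` {\<alpha> (turning i)..\<alpha> (Suc (turning i))}"
proof -
  have "\<alpha> (turning i) \<le> \<alpha> (Suc (turning i))" by simp
  then show ?thesis
    unfolding star_arc_def path_image_part_circlepath[OF \<open>\<alpha> (turning i) \<le> _\<close>] by (auto simp: cis_conv_exp)
qed

lemma star_arc_eq_\<gamma>: "star_arc i = \<gamma> ` {\<alpha> (turning i)..\<alpha> (Suc (turning i))}"
  unfolding star_arc_eq by (intro image_cong refl) (simp only: \<gamma>_turning)

lemma star_arc_add: "star_arc (i + m) = star_arc i"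
proof (cases "even i")
  case True
  then have t: "turning (i + m) = i + 2 * m" "turning i = i"
    using odd_m by (auto simp: turning_def)
  have "star_arc (i + m) = \<gamma> ` ((\<lambda>\<theta>. \<theta> + 2 * pi) ` {\<alpha> i..\<alpha> (Suc i)})"
    using \<alpha>_add_2m[of i] \<alpha>_add_2m[of "Suc i"] by (simp add: star_arc_eq_\<gamma> t add.commute)
  also have "\<dots> = \<gamma> ` {\<alpha> i..\<alpha> (Suc i)}"
    unfolding image_image
    by (intro image_cong refl \<gamma>_add_2pi) (auto intro: order_trans[OF \<alpha>_ge_0])
  finally show ?thesis
    by (simp add: star_arc_eq_\<gamma> t)
next
  case False
  then show ?thesis
    using odd_m by (simp add: star_arc_eq_\<gamma> turning_def)
qed

lemma star_arc_mod [simp]: "star_arc (i mod m) = star_arc i"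
  by (rule periodic_mod) (rule star_arc_add)

lemma star_arc_mod_in: "star_arc i \<in> star_arc ` {..<m}"
  using m_ge_3 star_arc_mod[of i] by (intro image_eqI[of _ _ "i mod m"]) auto

lemma star_arc_center:
  assumes "star_arc i \<subseteq> sphere c 1"
  shows "c = U i"
  using assms \<alpha>_Suc_less[of "turning i"]
  by (intro cis_arc_center_unique[of "\<alpha> (turning i)" "\<alpha> (Suc (turning i))"]) (auto simp: star_arc_eq image_subset_iff)

lemma star_arc_subset_sphere: "star_arc i \<subseteq> sphere (U i) 1"
  by (auto simp: star_arc_eq dist_norm)

text \<open>A resting point is also the starting point of the next turning run.\<close>

lemma \<gamma>_in_arc:
  assumes "0 \<le> \<theta>"
  shows "\<exists>i. \<gamma> \<theta> \<in> star_arc i"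
proof -
  let ?i = "run \<theta>"
  have \<theta>: "\<alpha> ?i \<le> \<theta>" "\<theta> \<le> \<alpha> (Suc ?i)"
    using less_\<alpha>_run[of \<theta>] \<alpha>_run_le[OF assms] by simp_all
  show ?thesis
  proof (cases "even ?i")
    case True
    then have "\<gamma> \<theta> \<in> star_arc ?i"
      using \<theta> by (auto simp: star_arc_eq_\<gamma> turning_def)
    then show ?thesis ..
  next
    case False
    then have "\<gamma> \<theta> = \<gamma> (\<alpha> (Suc ?i))"
      using \<gamma>_eq[OF \<theta>] by (simp add: \<gamma>_\<alpha>_Suc)
    also have "\<dots> \<in> star_arc (Suc ?i)"
      using False by (auto simp: star_arc_eq_\<gamma> turning_def)
    finally show ?thesis ..
  qed
qed

lemma Union_arcs: "\<Union> (star_arc ` {..<m}) = frontier R"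
proof -
  have "\<gamma> ` {0..} \<subseteq> \<Union> (star_arc ` {..<m})"
    using \<gamma>_in_arc star_arc_mod_in by force
  moreover have "star_arc i \<subseteq> \<gamma> ` {0..}" for i
    unfolding star_arc_eq_\<gamma> by (intro image_mono) (use \<alpha>_ge_0 order_trans in auto)
  ultimately show ?thesis
    unfolding frontier_R by blast
qed

text \<open>The arc around a vertex ends at the two neighbours of that vertex in the star, so arcs
  whose centres are two steps apart meet in the vertex between.\<close>

lemma U_in_arc: "U (Suc i) \<in> star_arc i" "U i \<in> star_arc (Suc i)"
proof -
  let ?t = "turning i"
  have "\<gamma> (\<alpha> (Suc ?t)) = U (Suc ?t)"
    using even_turning[of i] by (simp add: \<gamma>_\<alpha>_Suc)
  also have "\<dots> = U (Suc i)"
    using U_add[of "Suc i"] by (auto simp: turning_def)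
  finally show "U (Suc i) \<in> star_arc i"
    unfolding star_arc_eq_\<gamma> by (intro image_eqI[of _ _ "\<alpha> (Suc ?t)"]) simp_all
  let ?t = "turning (Suc i)"
  have "\<gamma> (\<alpha> ?t) = U (?t + m - 1)"
    using even_turning[of "Suc i"] by (intro \<gamma>_\<alpha>)
  also have "\<dots> = U i"
    using U_add[of i] U_add[of "i + m"] by (auto simp: turning_def)
  finally show "U i \<in> star_arc (Suc i)"
    unfolding star_arc_eq_\<gamma> by (intro image_eqI[of _ _ "\<alpha> ?t"]) simp_all
qed

text \<open>Equal arcs have equal centres, and by injectivity of \<open>U\<close> this would make
  \<open>m\<close> divide 2.\<close>

lemma star_arc_Suc_Suc_neq: "star_arc (Suc (Suc i)) \<noteq> star_arc i"
proof
  assume "star_arc (Suc (Suc i)) = star_arc i"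
  then have "U (Suc (Suc i)) = U i"
    using star_arc_center[of i "U (Suc (Suc i))"] star_arc_subset_sphere[of "Suc (Suc i)"] by simp
  then have "U (Suc (Suc i) mod m) = U (i mod m)" by simp
  then have "Suc (Suc i) mod m = i mod m"
    using inj_onD[OF inj_U] m_ge_3 by (metis lessThan_iff mod_less_divisor not_numeral_le_zero gr0I)
  then have "m dvd 2"
    using mod_eq_dvd_iff_nat[of i "Suc (Suc i)" m] by (metis add_2_eq_Suc add_diff_cancel_right' le_add2)
  then show False
    using m_ge_3 dvd_imp_le[of m 2] by simp
qed

text \<open>A point inside a turning run has only one normal, so arcs through it share their centre.
  Different arcs therefore meet only at ends of turning runs, which are vertices.\<close>

lemma arc_vertices_arcs: "arc_vertices (star_arc ` {..<m}) = U ` {..<m}"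
proof (intro equalityI subsetI)
  fix x assume "x \<in> arc_vertices (star_arc ` {..<m})"
  then obtain i j where ij: "star_arc i \<noteq> star_arc j" "x \<in> star_arc i" "x \<in> star_arc j" "i < m" "j < m"
    unfolding arc_vertices_def by auto
  let ?i = "turning i"
  obtain \<theta> where \<theta>: "\<alpha> ?i \<le> \<theta>" "\<theta> \<le> \<alpha> (Suc ?i)" "x = U i + cis \<theta>" "x = \<gamma> \<theta>"
    using ij(2) \<gamma>_turning[of _ i] unfolding star_arc_eq by auto
  obtain \<phi> where \<phi>: "\<alpha> (turning j) \<le> \<phi>" "x = U j + cis \<phi>" "x = \<gamma> \<phi>"
    using ij(3) \<gamma>_turning[of _ j] unfolding star_arc_eq by auto
  have "\<gamma> \<theta> \<in> {U (?i + m - 1), U (Suc ?i)}"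
  proof (intro turning_end even_turning \<theta>(1,2) notI)
    assume inside: "\<alpha> ?i < \<theta> \<and> \<theta> < \<alpha> (Suc ?i)"
    have "cis \<phi> = cis \<theta>"
    proof (rule turning_inj[OF even_turning])
      show "0 \<le> \<phi>" using \<phi>(1) \<alpha>_ge_0 order_trans by blast
    qed (use inside \<theta> \<phi> in auto)
    then have "U i = U j"
      using \<theta>(3) \<phi>(2) by simp
    then show False
      using ij inj_onD[OF inj_U] by blast
  qed
  then obtain k where "x = U k" using \<theta>(4) by auto
  then show "x \<in> U ` {..<m}"
    using m_ge_3 by (intro image_eqI[of _ _ "k mod m"]) auto
next
  fix x assume "x \<in> U ` {..<m}"
  then obtain i where i: "x = U i" by auto
  have "x = U (i + m)" using i by (simp add: U_add)
  then obtain j where j: "x = U (Suc j)"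
    using m_ge_3 by (cases "i + m") auto
  then have "x \<in> star_arc j \<inter> star_arc (Suc (Suc j))" using U_in_arc by simp
  then show "x \<in> arc_vertices (star_arc ` {..<m})"
    unfolding arc_vertices_def mem_Collect_eq
    by (intro bexI[of _ "star_arc (Suc (Suc j))"] bexI[of _ "star_arc j"] conjI star_arc_Suc_Suc_neq star_arc_mod_in) simp
qed

section \<open>The inscribed polygon\<close>

text \<open>The curve is sampled at all multiples of \<open>pi / n\<close>. The breakpoints
  \<open>\<alpha> i\<close> are among them, so every star vertex is hit; samples within a resting
  run coincide, which leaves \<open>n\<close> points out of \<open>2 * n\<close>.\<close>

definition V :: "nat \<Rightarrow> complex" where
  "V j = \<gamma> (pi * real j / real n)"

definition P :: "complex set" where
  "P = convex hull (range V)"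

lemma U_in_range_V: "U i \<in> range V"
proof -
  have "U i = V (K (resting i))"
    using \<gamma>_resting[of "\<alpha> (resting i)" i] by (simp add: V_def \<alpha>_def[symmetric])
  then show ?thesis by simp
qed

lemma V_add: "V (j + 2 * n) = V j"
proof -
  have "pi * real (j + 2 * n) / real n = pi * real j / real n + 2 * pi"
    using n_pos by (simp add: field_simps)
  then show ?thesis
    by (simp add: V_def \<gamma>_add_2pi)
qed

lemma V_mod: "V (j mod (2 * n)) = V j"
proof -
  have "V (i + k * (2 * n)) = V i" for i k
  proof (induction k)
    case (Suc k)
    then show ?case using V_add[of "i + k * (2 * n)"] by (simp add: algebra_simps)
  qed simp
  from this[of "j mod (2 * n)" "j div (2 * n)"] show ?thesis by (simp only: mod_mult_div_eq mod_div_mult_eq)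
qed

lemma range_V: "range V = V ` {..<2 * n}"
proof -
  have "V j \<in> V ` {..<2 * n}" for j
    using n_pos V_mod[of j] by (intro image_eqI[of _ _ "j mod (2 * n)"]) simp_all
  then show ?thesis by auto
qed

lemma V_shift:
  obtains k where "c \<le> k" "k < c + 2 * n" "V k = V j"
proof -
  \<comment> \<open>The term \<open>c * (2 * n - 1)\<close> acts as \<open>- c\<close> modulo
    \<open>2 * n\<close>.\<close>
  let ?k = "c + (j + c * (2 * n - 1)) mod (2 * n)"
  have "c + (j + c * (2 * n - 1)) = j + c * (2 * n)"
    using n_pos by (cases n) simp_all
  then have "?k mod (2 * n) = j mod (2 * n)"
    by (metis mod_add_right_eq mod_mult_self1)
  then have "V ?k = V j" by (metis V_mod)
  then show thesis using n_pos by (intro that[of ?k]) simp_all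
qed

lemma polytope_P: "polytope P"
  unfolding P_def by (intro polytope_convex_hull) (simp add: range_V)

lemma P_subset_R: "P \<subseteq> R"
  unfolding P_def by (intro hull_minimal convex_R) (auto simp: V_def intro: \<gamma>_in_R)

text \<open>A line containing \<open>P\<close> contains the star, so its normal would be orthogonal
  to the first two side directions, which are not parallel.\<close>

lemma interior_P: "interior P \<noteq> {}"
proof
  assume "interior P = {}"
  then obtain a b where a: "a \<noteq> 0" "P \<subseteq> {x. a \<bullet> x = b}"
    using empty_interior_subset_hyperplane[of P] by (auto simp: P_def)
  have U: "a \<bullet> U i = b" for i
    using U_in_range_V[of i] a(2) hull_subset[of "range V" convex] unfolding P_def by blast
  have "a \<bullet> cis (\<alpha> (Suc i)) = 0" for i
    using U[of i] U[of "Suc i"] by (simp add: U_Suc' inner_add_right minus_one_power_iff split: if_splits)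
  then have z: "Re a * cos (\<alpha> (Suc i)) + Im a * sin (\<alpha> (Suc i)) = 0" for i
    by (simp add: inner_complex_def)
  define x where "x = \<alpha> (Suc 0)"
  define y where "y = \<alpha> (Suc (Suc 0))"
  have xy: "Re a * cos x + Im a * sin x = 0" "Re a * cos y + Im a * sin y = 0"
    unfolding x_def y_def by (rule z)+
  have "0 < sin (y - x)"
    using \<alpha>_less_Suc[of "Suc 0"] \<alpha>_Suc_less[of "Suc 0"] by (intro sin_gt_zero) (auto simp: x_def y_def)
  moreover have "Re a * sin (y - x) = (Re a * cos x + Im a * sin x) * sin y - (Re a * cos y + Im a * sin y) * sin x"
    "Im a * sin (y - x) = (Re a * cos y + Im a * sin y) * cos x - (Re a * cos x + Im a * sin x) * cos y"
    by (simp_all add: sin_diff algebra_simps)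
  ultimately have "Re a = 0" "Im a = 0"
    unfolding xy by simp_all
  then show False
    using a(1) by (simp add: complex_eq_iff)
qed

section \<open>Vertices and edges of the polygon\<close>

text \<open>If a proper convex combination attains the maximal height over
  \<open>cis \<theta>\<close>, so do both of its ends, and \<open>support_unique\<close> identifies
  them.\<close>

lemma \<gamma>_extreme:
  assumes "0 \<le> \<theta>" "S \<subseteq> R" "\<gamma> \<theta> \<in> S"
  shows "\<gamma> \<theta> extreme_point_of S"
  unfolding extreme_point_of_def
proof (intro conjI ballI notI)
  fix a b assume ab: "a \<in> S" "b \<in> S" "\<gamma> \<theta> \<in> open_segment a b"
  then obtain u where u: "0 < u" "u < 1" "\<gamma> \<theta> = (1 - u) *\<^sub>R a + u *\<^sub>R b" "a \<noteq> b"
    by (auto simp: in_segment)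
  have le: "a \<bullet> cis \<theta> \<le> \<gamma> \<theta> \<bullet> cis \<theta>" "b \<bullet> cis \<theta> \<le> \<gamma> \<theta> \<bullet> cis \<theta>"
    using ab assms R_width(1) by auto
  have eq: "(1 - u) * (\<gamma> \<theta> \<bullet> cis \<theta> - a \<bullet> cis \<theta>) + u * (\<gamma> \<theta> \<bullet> cis \<theta> - b \<bullet> cis \<theta>) = 0"
    using arg_cong[OF u(3), of "\<lambda>x. x \<bullet> cis \<theta>"] by (simp add: inner_add_left algebra_simps)
  have "0 \<le> (1 - u) * (\<gamma> \<theta> \<bullet> cis \<theta> - a \<bullet> cis \<theta>)" "0 \<le> u * (\<gamma> \<theta> \<bullet> cis \<theta> - b \<bullet> cis \<theta>)"
    using u le by simp_all
  then have "(1 - u) * (\<gamma> \<theta> \<bullet> cis \<theta> - a \<bullet> cis \<theta>) = 0" "u * (\<gamma> \<theta> \<bullet> cis \<theta> - b \<bullet> cis \<theta>) = 0"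
    using eq by linarith+
  then have "a = \<gamma> \<theta>" "b = \<gamma> \<theta>"
    using u(1,2) ab assms by (intro support_unique; auto)+
  with u show False by simp
qed (rule assms)

lemma polygon_vertices_P: "polygon_vertices P = range V"
proof (intro equalityI subsetI)
  fix x assume "x \<in> polygon_vertices P"
  then show "x \<in> range V"
    unfolding polygon_vertices_def P_def using extreme_point_of_convex_hull by blast
next
  fix x assume "x \<in> range V"
  then obtain j where "x = \<gamma> (pi * real j / real n)" "x \<in> P"
    by (auto simp: P_def V_def hull_inc)
  then show "x \<in> polygon_vertices P"
    unfolding polygon_vertices_def using P_subset_R by (auto intro: \<gamma>_extreme)
qed

text \<open>The breakpoints are multiples of \<open>pi / n\<close>, so no sampling step straddles
  one.\<close>

lemma V_run:
  obtains i where "K i \<le> j" "j < K (Suc i)" "\<alpha> i \<le> pi * real j / real n"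
    "pi * real (Suc j) / real n \<le> \<alpha> (Suc i)" "i = run (pi * real j / real n)"
proof
  let ?i = "run (pi * real j / real n)"
  have "pi * real (K ?i) \<le> pi * real j" "pi * real j < pi * real (K (Suc ?i))"
    using \<alpha>_run_le[of "pi * real j / real n"] less_\<alpha>_run[of "pi * real j / real n"] n_pos
    by (simp_all add: \<alpha>_def divide_le_cancel divide_less_cancel)
  then show K: "K ?i \<le> j" "j < K (Suc ?i)" by simp_all
  then show "\<alpha> ?i \<le> pi * real j / real n" "pi * real (Suc j) / real n \<le> \<alpha> (Suc ?i)"
    unfolding \<alpha>_def by (intro divide_right_mono mult_left_mono; simp)+
qed simp

text \<open>This is the source of equal sides: a step is either zero or a chord of angle
  \<open>pi / n\<close> on a unit circle.\<close>

lemma V_Suc: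
  "V (Suc j) - V j = (if even (run (pi * real j / real n)) then (cis (pi / real n) - 1) * cis (pi * real j / real n) else 0)"
proof -
  let ?\<theta> = "pi * real j / real n"
  have le: "?\<theta> \<le> pi * real (Suc j) / real n"
    by (simp add: divide_right_mono)
  obtain i where i: "\<alpha> i \<le> ?\<theta>" "pi * real (Suc j) / real n \<le> \<alpha> (Suc i)" "i = run ?\<theta>"
    using V_run by metis
  have "V j = U i + (if even i then cis ?\<theta> else 0)"
    "V (Suc j) = U i + (if even i then cis (pi * real (Suc j) / real n) else 0)"
    unfolding V_def using i le by (intro \<gamma>_eq; linarith)+
  moreover have "cis (pi * real (Suc j) / real n) = cis (pi / real n) * cis ?\<theta>"
    by (simp add: cis_mult add_divide_distrib[symmetric] algebra_simps)
  ultimately show ?thesis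
    using i(3) by (simp add: algebra_simps)
qed

lemma V_Suc_neq:
  assumes "even (run (pi * real j / real n))"
  shows "V (Suc j) \<noteq> V j"
proof -
  obtain i where i: "\<alpha> i \<le> pi * real j / real n" "pi * real (Suc j) / real n \<le> \<alpha> (Suc i)"
    "i = run (pi * real j / real n)"
    using V_run by metis
  have "V j \<noteq> V (Suc j)"
    unfolding V_def using i assms n_pos by (intro turning_neq[of i]) (auto simp: divide_strict_right_mono)
  then show ?thesis by simp
qed

text \<open>A coincidence would make the curve rest from \<open>j\<close> on or from
  \<open>k\<close> on, but both indices begin a turning step.\<close>

lemma V_neq:
  assumes "j < k" "k < j + 2 * n" "even (run (pi * real j / real n))" "even (run (pi * real k / real n))"
  shows "V j \<noteq> V k"
proof
  let ?x = "\<lambda>j. pi * real j / real n"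
  assume eq: "V j = V k"
  have x: "?x i \<le> ?x l \<longleftrightarrow> i \<le> l" for i l
    using n_pos by (simp add: divide_le_cancel)
  have x2: "?x j + 2 * pi = ?x (j + 2 * n)"
    using n_pos by (simp add: field_simps)
  have "(\<forall>\<psi>\<in>{?x j..?x k}. \<gamma> \<psi> = \<gamma> (?x j)) \<or> (\<forall>\<psi>\<in>{?x k..?x j + 2 * pi}. \<gamma> \<psi> = \<gamma> (?x j))"
    using eq assms unfolding V_def by (intro \<gamma>_eq_cases) (simp_all only: x x2, simp_all)
  then show False
  proof
    assume 1: "\<forall>\<psi>\<in>{?x j..?x k}. \<gamma> \<psi> = \<gamma> (?x j)"
    have "\<gamma> (?x (Suc j)) = \<gamma> (?x j)"
      using assms by (intro bspec[OF 1]) (simp only: atLeastAtMost_iff x, simp)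
    then show False
      using V_Suc_neq[OF assms(3)] by (simp add: V_def)
  next
    assume 2: "\<forall>\<psi>\<in>{?x k..?x j + 2 * pi}. \<gamma> \<psi> = \<gamma> (?x j)"
    have "\<gamma> (?x (Suc k)) = \<gamma> (?x j)" "\<gamma> (?x k) = \<gamma> (?x j)"
      using assms by (intro bspec[OF 2]; simp only: atLeastAtMost_iff x x2; simp)+
    then show False
      using V_Suc_neq[OF assms(4)] by (simp add: V_def)
  qed
qed

text \<open>One index for each polygon vertex: the one at which the curve leaves it.\<close>

definition J :: "nat set" where
  "J = {j. j < 2 * n \<and> even (run (pi * real j / real n))}"

text \<open>A half-turn exchanges turning and resting, so for each \<open>j < n\<close> exactly one
  of \<open>j\<close> and \<open>j + n\<close> belongs to \<open>J\<close>.\<close>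

lemma card_J: "card J = n"
proof -
  let ?T = "\<lambda>j. even (run (pi * real j / real n))"
  have flip: "?T (j + n) \<longleftrightarrow> \<not> ?T j" for j
  proof -
    have "pi * real (j + n) / real n = pi * real j / real n + pi"
      using n_pos by (simp add: field_simps)
    then show ?thesis using odd_m by (simp add: run_add_m)
  qed
  define A where "A = {j. j < n \<and> ?T j}"
  define B where "B = {j. j < n \<and> \<not> ?T j}"
  have "J = A \<union> (\<lambda>j. j + n) ` B"
  proof (intro equalityI subsetI)
    fix j assume j: "j \<in> J"
    show "j \<in> A \<union> (\<lambda>j. j + n) ` B"
    proof (cases "j < n")
      case False
      then have "j = (j - n) + n" by simp
      moreover have "j - n < n" using j False by (auto simp: J_def)
      ultimately have "j - n \<in> B" using j flip[of "j - n"] by (simp add: J_def B_def)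
      then show ?thesis using \<open>j = (j - n) + n\<close> by blast
    qed (use j in \<open>simp add: J_def A_def\<close>)
  next
    fix j assume "j \<in> A \<union> (\<lambda>j. j + n) ` B"
    then consider "j \<in> A" | i where "i \<in> B" "j = i + n" by blast
    then show "j \<in> J"
    proof cases
      case 2
      then show ?thesis using flip[of i] by (simp add: J_def B_def)
    qed (simp add: J_def A_def)
  qed
  moreover have "A \<inter> (\<lambda>j. j + n) ` B = {}"
    by (auto simp: A_def)
  moreover have "finite A" "finite B"
    by (simp_all add: A_def B_def)
  ultimately have "card J = card A + card B"
    by (simp add: card_Un_disjoint card_image)
  also have "\<dots> = card (A \<union> B)"
    by (rule card_Un_disjoint[symmetric]) (auto simp: A_def B_def)
  also have "A \<union> B = {..<n}" by (auto simp: A_def B_def)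
  finally show ?thesis by simp
qed

lemma K_add_2m: "K (i + 2 * m) = K i + 2 * n"
proof -
  have "i + 2 * m = i + m + m" by simp
  then show ?thesis by (simp only: K_add)
qed

text \<open>A sample in a resting run equals the sample at the end of that run, where a turning run
  starts.\<close>

lemma V_image_J: "V ` J = range V"
proof -
  have "V j \<in> V ` J" if "j < 2 * n" for j
  proof (cases "even (run (pi * real j / real n))")
    case True
    then show ?thesis using that by (auto simp: J_def)
  next
    case False
    obtain i where i: "K i \<le> j" "\<alpha> i \<le> pi * real j / real n"
      "pi * real (Suc j) / real n \<le> \<alpha> (Suc i)" "i = run (pi * real j / real n)"
      using V_run by metis
    have "pi * real j / real n \<le> pi * real (Suc j) / real n"
      by (simp add: divide_right_mono)
    then have "V j = U i"
      unfolding V_def using \<gamma>_eq[of i "pi * real j / real n"] i False by auto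
    also have "\<dots> = V (K (Suc i))"
      using \<gamma>_\<alpha>_Suc[of i] i(4) False by (simp add: V_def \<alpha>_def)
    finally have Vj: "V j = V (K (Suc i))" .
    have "K i < K (0 + 2 * m)"
      using i(1) that unfolding K_add_2m by (simp add: K_0)
    then have "i < 2 * m"
      using strict_mono_less[OF K_mono] by simp
    then have K: "K (Suc i) \<le> 2 * n"
      using strict_mono_less_eq[OF K_mono, of "Suc i" "0 + 2 * m"] unfolding K_add_2m by (simp add: K_0)
    show ?thesis
    proof (cases "K (Suc i) < 2 * n")
      case True
      have "run (\<alpha> (Suc i)) = Suc i"
        by (intro run_eqI) simp_all
      then have "K (Suc i) \<in> J"
        using True False i(4) by (simp add: J_def \<alpha>_def)
      then show ?thesis using Vj by auto
    next
      case False
      \<comment> \<open>This resting run ends exactly with the full turn, that is, at index 0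
        again.\<close>
      then have "V j = V 0"
        using K Vj V_add[of 0] by simp
      moreover have "run 0 = 0"
        using \<alpha>_less_Suc[of 0] by (intro run_eqI) simp_all
      then have "0 \<in> J"
        using n_pos by (simp add: J_def)
      ultimately show ?thesis by auto
    qed
  qed
  then have "range V \<subseteq> V ` J" unfolding range_V by blast
  then show ?thesis by blast
qed

lemma card_range_V: "card (range V) = n"
proof -
  have "inj_on V J"
  proof (rule inj_onI, rule ccontr)
    fix j k assume "j \<in> J" "k \<in> J" "V j = V k" "j \<noteq> k"
    then show False
      using V_neq[of j k] V_neq[of k j] by (auto simp: J_def linorder_neq_iff)
  qed
  then have "card (V ` J) = card J" by (rule card_image)
  then show ?thesis by (simp add: V_image_J card_J)
qed

text \<open>
  An edge is the set of maximizers of some \<open>cis \<theta>\<close>; by \<open>\<gamma>_mono\<close> these are spanned by the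
  two vertices whose parameters enclose \<open>\<theta>\<close>.
\<close>

lemma diameter_edge:
  assumes "e edge_of P"
  shows "diameter e = norm (cis (pi / real n) - 1)"
proof -
  let ?x = "\<lambda>j. pi * real j / real n"
  have e: "e face_of P" "aff_dim e = 1"
    using assms by (auto simp: edge_of_def)
  have "e exposed_face_of P"
    using e(1) polytope_P by (simp add: exposed_face_of_polyhedron polytope_imp_polyhedron)
  then obtain a b where ab: "P \<subseteq> {x. a \<bullet> x \<le> b}" "e = P \<inter> {x. a \<bullet> x = b}"
    by (auto simp: exposed_face_of_def)
  \<comment> \<open>For \<open>a = 0\<close> the face would be empty or all of \<open>P\<close>,
    which has dimension 2.\<close>
  have "a \<noteq> 0"
  proof
    assume "a = 0"
    then have "e = P \<or> e = {}" using ab(2) by (cases "b = 0") auto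
    then show False
      using e(2) aff_dim_nonempty_interior[OF interior_P] by auto
  qed
  then obtain \<theta> where \<theta>: "0 \<le> \<theta>" "sgn a = cis \<theta>"
    using unit_eq_cis by (metis norm_sgn)
  have a: "a = norm a *\<^sub>R cis \<theta>"
    using \<theta>(2) by (metis scaleR_conv_of_real sgn_eq mult.commute nonzero_divide_eq_eq \<open>a \<noteq> 0\<close> norm_eq_zero of_real_eq_0_iff)
  obtain S where S: "S \<subseteq> range V" "e = convex hull S"
    using face_of_convex_hull_subset[of "range V" e] e(1) finite_imp_compact unfolding P_def range_V by blast
  have max: "V k \<bullet> cis \<theta> \<le> x \<bullet> cis \<theta>" if "x \<in> S" for x k
  proof -
    have "a \<bullet> x = b"
      using ab(2) S(2) that hull_inc[of x S convex] by blast
    moreover have "a \<bullet> V k \<le> b"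
      using ab(1) hull_inc[of "V k" "range V" convex] unfolding P_def by blast
    ultimately have "norm a * (cis \<theta> \<bullet> V k) \<le> norm a * (cis \<theta> \<bullet> x)"
      using a by (metis inner_scaleR_left)
    then show ?thesis
      using \<open>a \<noteq> 0\<close> by (simp add: inner_commute)
  qed
  \<comment> \<open>The sampling step containing \<open>\<theta>\<close>.\<close>
  define j where "j = nat \<lfloor>\<theta> * real n / pi\<rfloor>"
  have "real j \<le> \<theta> * real n / pi" "\<theta> * real n / pi < real (Suc j)"
    using \<theta>(1) unfolding j_def by (simp_all add: of_nat_nat) linarith+
  then have j: "?x j \<le> \<theta>" "\<theta> \<le> ?x (Suc j)"
    using n_pos by (simp_all add: field_simps)
  have x2: "?x j + 2 * pi = ?x (j + 2 * n)"
    using n_pos by (simp add: field_simps)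
  have "S \<subseteq> {V j, V (Suc j)}"
  proof
    fix x assume x: "x \<in> S"
    then obtain l where "x = V l" using S(1) by auto
    \<comment> \<open>In the turn after \<open>Suc j\<close>, heights first descend from
      \<open>V (Suc j)\<close> and then ascend to \<open>V (j + 2 * n) = V j\<close>.\<close>
    then obtain k where k: "Suc j \<le> k" "k < Suc j + 2 * n" "x = V k"
      using V_shift[of "Suc j" l] by metis
    show "x \<in> {V j, V (Suc j)}"
    proof (cases "?x k \<le> \<theta> + pi")
      case True
      have "?x (Suc j) \<le> ?x k"
        using k(1) n_pos by (simp add: divide_right_mono)
      then have "V k \<bullet> cis \<theta> < V (Suc j) \<bullet> cis \<theta> \<or> V k = V (Suc j)"
        unfolding V_def using True \<theta>(1) j(2) by (intro \<gamma>_mono)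
      then show ?thesis
        using max[OF x, of "Suc j"] k(3) by auto
    next
      case False
      have "?x k \<le> ?x (j + 2 * n)"
        using k(2) by (intro divide_right_mono mult_left_mono) simp_all
      then have "V k \<bullet> cis \<theta> < V (j + 2 * n) \<bullet> cis \<theta> \<or> V (j + 2 * n) = V k"
        unfolding V_def using False \<theta>(1) j(1) x2 by (intro \<gamma>_mono') simp_all
      then show ?thesis
        using max[OF x, of j] k(3) by (auto simp: V_add)
    qed
  qed
  then have "S = {} \<or> S = {V j} \<or> S = {V (Suc j)} \<or> S = {V j, V (Suc j)}"
    by blast
  moreover have dim: "aff_dim S = 1"
    using e(2) S(2) by (simp add: aff_dim_convex_hull)
  ultimately have S_eq: "S = {V j, V (Suc j)}"
    by (elim disjE; simp)
  then have neq: "V j \<noteq> V (Suc j)"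
    using dim by (simp split: if_splits)
  have "diameter e = norm (V (Suc j) - V j)"
    by (simp add: S(2) S_eq diameter_segment dist_norm norm_minus_commute)
  also have "V (Suc j) - V j = (cis (pi / real n) - 1) * cis (?x j)"
    using V_Suc[of j] neq by (metis right_minus_eq)
  finally show ?thesis
    by (simp add: norm_mult)
qed

lemma equilateral_P: "equilateral_convex_polygon n P"
  unfolding equilateral_convex_polygon_def polygon_vertices_P
  using polytope_P aff_dim_nonempty_interior[OF interior_P] card_range_V diameter_edge by auto

text \<open>An arc determines its centre and the centres are distinct, so different arcs lie on
  different circles.\<close>

lemma reuleaux_polygon_R: "reuleaux_polygon R (star_arc ` {..<m})"
  unfolding reuleaux_polygon_def
proof (intro conjI)
  show "interior R \<noteq> {}"
    using interior_P interior_mono[OF P_subset_R] by auto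
  have "circular_arc 1 (star_arc i)" for i
    unfolding circular_arc_def star_arc_def
    using \<alpha>_less_Suc[of "turning i"] \<alpha>_Suc_less[of "turning i"] pi_gt_zero
    by (intro exI conjI) (assumption, linarith, rule refl)
  moreover have "U i = U j" if "star_arc i \<subseteq> sphere c 1" "star_arc j \<subseteq> sphere c 1" for i j c
    using star_arc_center that by metis
  then have "star_arc i = star_arc j" if "star_arc i \<subseteq> sphere c 1" "star_arc j \<subseteq> sphere c 1" "i < m" "j < m" for i j c
    using that inj_onD[OF inj_U, of i j] by blast
  ultimately show "\<exists>\<rho>>0. (\<forall>A\<in>star_arc ` {..<m}. circular_arc \<rho> A) \<and>
        (\<forall>A\<in>star_arc ` {..<m}. \<forall>B\<in>star_arc ` {..<m}. A \<noteq> B \<longrightarrow> A \<inter> B \<noteq> {} \<longrightarrow>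
           \<not> (\<exists>c. A \<subseteq> sphere c \<rho> \<and> B \<subseteq> sphere c \<rho>))"
    by (intro exI[of _ 1]) (simp, blast)
qed (simp_all add: compact_R convex_R constant_width_R Union_arcs)

lemma diameter_P: "diameter P = 1" and diameter_R: "diameter R = 1"
proof -
  have "\<gamma> 0 = V 0" "\<gamma> pi = V n"
    using n_pos by (simp_all add: V_def)
  then have "\<gamma> 0 \<in> P" "\<gamma> pi \<in> P"
    by (simp_all add: P_def hull_inc)
  then show "diameter P = 1" "diameter R = 1"
    using P_subset_R by (auto intro: diameter_eq_1)
qed

lemma reinhardt_inscribed_P: "reinhardt_inscribed P R (star_arc ` {..<m})"
  unfolding reinhardt_inscribed_def polygon_vertices_P frontier_R arc_vertices_arcs diameter_P diameter_R
  using reuleaux_polygon_R P_subset_R U_in_range_V by (auto simp: V_def)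

end

text \<open>The root condition says \<open>U m = 0\<close>, that is, the star closes. Continuing
  \<open>ks\<close> periodically then gives an instance of \<open>closed_star\<close>.\<close>

lemma reinhardt_compositionI:
  assumes ks: "odd_composition n ks"
    and root: "(\<Sum>i<length ks. (-1) ^ i * cis (pi * real (sum_list (take (Suc i) ks)) / real n)) = 0"
  shows "\<exists>P. reinhardt_composition n P ks"
proof -
  define m where "m = length ks"
  define k where "k i = ks ! (i mod m)" for i
  define K where "K i = (\<Sum>j<i. k j)" for i
  define U where "U i = (\<Sum>j<i. (-1) ^ j * cis (pi * real (K (Suc j)) / real n))" for i
  have k_pos: "0 < ks ! i" if "i < m" for i
    using ks that unfolding odd_composition_def m_def by (metis gr0I nth_mem)
  have m: "odd m" "m > 0"
    using ks by (auto simp: odd_composition_def m_def odd_pos)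
  have K_take: "K i = sum_list (take i ks)" if "i \<le> m" for i
    using that by (simp add: K_def k_def m_def sum_list_sum_nth atLeast0LessThan)
  have K_m: "K m = n"
    using K_take[of m] ks by (simp add: m_def odd_composition_def)
  have K_add: "K (i + m) = K i + n" for i
  proof (induction i)
    case (Suc i)
    then show ?case by (simp add: K_def k_def)
  qed (simp add: K_m, simp add: K_def)
  have n: "n > 0"
  proof -
    have "0 < K m"
      unfolding K_def by (rule sum_pos2[of _ 0]) (use m k_pos[of 0] in \<open>auto simp: k_def\<close>)
    then show ?thesis by (simp add: K_m)
  qed
  have U_m: "U m = 0"
    using root by (simp add: U_def K_take Suc_le_eq m_def)
  \<comment> \<open>After \<open>m\<close> steps the angle has grown by \<open>pi\<close> and the
    sign has changed by \<open>(-1) ^ m = - 1\<close>, so the increments repeat.\<close>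
  have U_add: "U (i + m) = U i" for i
  proof (induction i)
    case (Suc i)
    have "pi * real (K (Suc i + m)) / real n = pi * real (K (Suc i)) / real n + pi"
      using n unfolding K_add by (simp add: field_simps)
    then have "U (Suc (i + m)) = U (i + m) + (-1) ^ i * cis (pi * real (K (Suc i)) / real n)"
      using m by (simp add: U_def power_add)
    then show ?case
      using Suc by (simp add: U_def)
  qed (simp add: U_m, simp add: U_def)
  interpret closed_star n m K U
  proof
    show "K i < K (Suc i)" for i
      using k_pos[of "i mod m"] m by (simp add: K_def k_def)
  qed (use m K_add U_add in \<open>simp_all add: K_def U_def\<close>)
  have "reinhardt_polygon n P"
    unfolding reinhardt_polygon_def using equilateral_P reinhardt_inscribed_P by blast
  moreover have "star_polygon (arc_vertices (star_arc ` {..<m})) (diameter R) (map U [0..<m])"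
    by (simp only: arc_vertices_arcs diameter_R star_polygon_U)
  moreover have "\<forall>i<m. angle_at (map U [0..<m] ! i) (map U [0..<m] ! ((i + m - 1) mod m))
      (map U [0..<m] ! (Suc i mod m)) = real (ks ! i) * pi / real n"
  proof (intro allI impI)
    fix i assume "i < m"
    then have "K (Suc i) - K i = ks ! i"
      by (simp add: K_def k_def)
    with star_angle[OF \<open>i < m\<close>]
    show "angle_at (map U [0..<m] ! i) (map U [0..<m] ! ((i + m - 1) mod m))
      (map U [0..<m] ! (Suc i mod m)) = real (ks ! i) * pi / real n"
      by (simp only:)
  qed
  moreover have "length (map U [0..<m]) = m" by simp
  ultimately have "reinhardt_composition n P ks"
    unfolding reinhardt_composition_def Let_def using ks reinhardt_inscribed_P m_def by metis
  then show ?thesis ..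
qed

section \<open>Compositions from sign sequences\<close>

fun run_bits :: "bool \<Rightarrow> nat list \<Rightarrow> bool list" where
  "run_bits b [] = []"
| "run_bits b (k # ks) = replicate k b @ run_bits (\<not> b) ks"

abbreviation bit_sign :: "bool \<Rightarrow> 'a :: comm_ring_1" where
  "bit_sign b \<equiv> if b then 1 else - 1"

lemma length_run_bits [simp]: "length (run_bits b ks) = sum_list ks"
  by (induction ks arbitrary: b) simp_all

lemma sum_lessThan_add:
  fixes g :: "nat \<Rightarrow> 'a :: comm_monoid_add"
  shows "(\<Sum>j<k + l. g j) = (\<Sum>j<k. g j) + (\<Sum>j<l. g (k + j))"
  by (induction l) (simp_all add: add.assoc)

text \<open>Multiplication by \<open>z - 1\<close> telescopes every run, so only the sign changes
  survive, with coefficient 2, and the two ends. For odd length and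
  \<open>z ^ sum_list ks = - 1\<close> the end terms cancel.\<close>

lemma sum_run_bits:
  fixes z :: "'a :: comm_ring_1"
  shows "(z - 1) * (\<Sum>j<sum_list ks. bit_sign (run_bits b ks ! j) * z ^ j) =
    bit_sign b * (2 * (\<Sum>i<length ks. (-1) ^ i * z ^ sum_list (take (Suc i) ks)) - 1
      + (-1) ^ length ks * z ^ sum_list ks)"
proof (induction ks arbitrary: b)
  case (Cons k ks)
  let ?T = "\<Sum>i<length ks. (-1) ^ i * z ^ sum_list (take (Suc i) ks)"
  let ?S = "\<Sum>j<sum_list ks. bit_sign (run_bits (\<not> b) ks ! j) * z ^ j"
  have "(\<Sum>j<sum_list (k # ks). bit_sign (run_bits b (k # ks) ! j) * z ^ j)
      = bit_sign b * (\<Sum>j<k. z ^ j) + z ^ k * ?S"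
    by (simp add: sum_lessThan_add nth_append sum_distrib_left power_add algebra_simps)
  then have "(z - 1) * (\<Sum>j<sum_list (k # ks). bit_sign (run_bits b (k # ks) ! j) * z ^ j)
      = bit_sign b * ((z - 1) * (\<Sum>j<k. z ^ j)) + z ^ k * ((z - 1) * ?S)"
    by (simp add: algebra_simps)
  also have "(z - 1) * (\<Sum>j<k. z ^ j) = z ^ k - 1"
    by (rule power_diff_1_eq[symmetric])
  also have "(z - 1) * ?S = - bit_sign b * (2 * ?T - 1 + (-1) ^ length ks * z ^ sum_list ks)"
    unfolding Cons.IH by simp
  also have "bit_sign b * (z ^ k - 1) + z ^ k * (- bit_sign b * (2 * ?T - 1 + (-1) ^ length ks * z ^ sum_list ks))
      = bit_sign b * (2 * (z ^ k - z ^ k * ?T) - 1 - (-1) ^ length ks * z ^ (k + sum_list ks))"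
    by (simp add: algebra_simps power_add)
  also have "z ^ k - z ^ k * ?T = (\<Sum>i<length (k # ks). (-1) ^ i * z ^ sum_list (take (Suc i) (k # ks)))"
    by (simp add: sum.lessThan_Suc_shift sum_distrib_left sum_negf power_add mult.left_commute del: sum.lessThan_Suc)
  finally show ?case by simp
qed simp

text \<open>A new first bit either lengthens the first run or opens a run of length 1.\<close>

lemma run_bits_exists:
  assumes "bs \<noteq> []"
  shows "\<exists>ks. ks \<noteq> [] \<and> 0 \<notin> set ks \<and> run_bits (hd bs) ks = bs"
  using assms
proof (induction bs)
  case (Cons x bs)
  show ?case
  proof (cases "bs = []")
    case True
    then show ?thesis by (intro exI[of _ "[1]"]) simp
  next
    case False
    then obtain k ks where ks: "0 \<notin> set (k # ks)" "run_bits (hd bs) (k # ks) = bs"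
      using Cons.IH by (metis neq_Nil_conv)
    show ?thesis
    proof (cases "hd bs = x")
      case True
      then show ?thesis using ks by (intro exI[of _ "Suc k # ks"]) auto
    next
      case False
      then have "hd bs = (\<not> x)" by auto
      then show ?thesis using ks by (intro exI[of _ "1 # k # ks"]) auto
    qed
  qed
qed simp

lemma last_run_bits:
  assumes "ks \<noteq> []" "0 \<notin> set ks"
  shows "last (run_bits b ks) = (b = odd (length ks))"
  using assms
proof (induction ks arbitrary: b)
  case (Cons k ks)
  show ?case
  proof (cases "ks = []")
    case False
    then have "run_bits (\<not> b) ks \<noteq> []"
      using Cons.prems by (cases ks) auto
    then show ?thesis using Cons False by auto
  qed (use Cons.prems in simp)
qed simp

lemma odd_composition_of_bits:
  assumes "length bs = n" "n > 0" "hd bs" "last bs"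
  obtains ks where "odd_composition n ks" "run_bits True ks = bs"
proof -
  have "bs \<noteq> []" using assms by auto
  then obtain ks where ks: "ks \<noteq> []" "0 \<notin> set ks" "run_bits True ks = bs"
    using run_bits_exists[of bs] assms by auto
  moreover have "sum_list ks = n"
    using ks(3) assms(1) length_run_bits by metis
  moreover have "odd (length ks)"
    using last_run_bits[OF ks(1,2), of True] ks(3) assms by simp
  ultimately show thesis
    by (intro that[of ks]) (auto simp: odd_composition_def)
qed

lemma reinhardt_composition_of_bits:
  assumes ks: "odd_composition n ks" and "n > 0"
    and bits: "(\<Sum>j<n. bit_sign (run_bits True ks ! j) * cis (pi / real n) ^ j) = 0"
  shows "\<exists>P. reinhardt_composition n P ks"
proof (rule reinhardt_compositionI[OF ks])
  let ?z = "cis (pi / real n)"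
  have ks': "sum_list ks = n" "odd (length ks)"
    using ks by (auto simp: odd_composition_def)
  have z: "?z ^ k = cis (pi * real k / real n)" for k
    by (simp add: Complex.DeMoivre algebra_simps)
  have "?z ^ n = - 1"
    unfolding z using \<open>n > 0\<close> by simp
  then have "2 * (\<Sum>i<length ks. (-1) ^ i * ?z ^ sum_list (take (Suc i) ks)) = 0"
    using sum_run_bits[where z = ?z and ks = ks and b = True] ks' bits by simp
  then show "(\<Sum>i<length ks. (-1) ^ i * cis (pi * real (sum_list (take (Suc i) ks)) / real n)) = 0"
    by (simp only: z) simp
qed

section \<open>Vanishing sums of periodic patterns\<close>

lemma sum_nat_group_mod:
  fixes g :: "nat \<Rightarrow> 'a :: comm_monoid_add"
  shows "(\<Sum>j<l * k. g j) = (\<Sum>x<l. \<Sum>y<k. g (x * k + y))"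
  by (induction l) (simp_all add: sum_lessThan_add add.commute[of k])

text \<open>Writing exponents as \<open>x * d + y\<close> splits off the geometric sum of
  \<open>z ^ d\<close>, a nontrivial \<open>e\<close>-th root of unity.\<close>

lemma sum_periodic_eq_0:
  fixes z :: "'a :: field"
  assumes "z ^ d \<noteq> 1" "z ^ (e * d) = 1" "\<And>x y. y < d \<Longrightarrow> h (x * d + y) = h y"
  shows "(\<Sum>t<e * d. h t * z ^ t) = 0"
proof -
  have "(\<Sum>t<e * d. h t * z ^ t) = (\<Sum>x<e. \<Sum>y<d. (z ^ d) ^ x * (h y * z ^ y))"
    unfolding sum_nat_group_mod
  proof (intro sum.cong refl)
    fix x y assume "y \<in> {..<d}"
    then have "h (x * d + y) = h y" by (simp add: assms(3))
    moreover have "z ^ (x * d + y) = (z ^ d) ^ x * z ^ y"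
      by (simp add: power_add power_mult[symmetric] mult.commute)
    ultimately show "h (x * d + y) * z ^ (x * d + y) = (z ^ d) ^ x * (h y * z ^ y)"
      by (simp add: mult.left_commute)
  qed
  also have "\<dots> = (\<Sum>x<e. (z ^ d) ^ x) * (\<Sum>y<d. h y * z ^ y)"
    by (simp add: sum_product)
  also have "(\<Sum>x<e. (z ^ d) ^ x) = 0"
  proof -
    have "(z ^ d) ^ e = 1"
      using assms(2) by (simp add: power_mult[symmetric] mult.commute)
    then show ?thesis
      using assms(1) by (simp add: geometric_sum)
  qed
  finally show ?thesis by simp
qed

text \<open>
  On each residue class modulo \<open>r\<close>, after twisting by the alternating sign, the bits
  are either periodic modulo \<open>q\<close> or equal to one fixed pattern that is periodic modulo \<open>p\<close>.
\<close>

definition residue_pattern :: "nat \<Rightarrow> nat \<Rightarrow> nat set option \<Rightarrow> nat \<Rightarrow> bool" where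
  "residue_pattern p q c t = (case c of None \<Rightarrow> p dvd t | Some W \<Rightarrow> t mod q \<in> W)"

definition mixed_bit :: "nat \<Rightarrow> nat \<Rightarrow> nat \<Rightarrow> (nat \<Rightarrow> nat set option) \<Rightarrow> nat \<Rightarrow> bool" where
  "mixed_bit p q r f j \<longleftrightarrow> residue_pattern p q (f (j mod r)) (j div r) = even (j div r)"

text \<open>The first \<open>q\<close> values tell \<open>q\<close>-periodic patterns apart. The
  multiples of \<open>p\<close> are not \<open>q\<close>-periodic, as they contain 0 but not
  \<open>q\<close>.\<close>

lemma residue_pattern_inj:
  assumes "prime p" "prime q" "p < q" "C \<in> insert None (Some ` Pow {..<q})" "D \<in> insert None (Some ` Pow {..<q})"
    and eq: "\<And>t. t < p * q \<Longrightarrow> residue_pattern p q C t = residue_pattern p q D t"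
  shows "C = D"
proof -
  have pq: "1 < p" "1 < q" using assms prime_gt_1_nat by auto
  have lt: "t < p * q" if "t \<le> q" for t
  proof -
    have "q < p * q" using pq by simp
    with that show ?thesis by linarith
  qed
  have ndvd: "\<not> p dvd q"
    using assms(1-3) primes_dvd_imp_eq by blast
  have None_Some: "\<exists>t<p * q. residue_pattern p q None t \<noteq> residue_pattern p q (Some W) t" for W
  proof (cases "0 \<in> W")
    case True
    then show ?thesis using ndvd lt[of q] by (intro exI[of _ q]) (simp add: residue_pattern_def)
  next
    case False
    then show ?thesis using lt[of 0] by (intro exI[of _ 0]) (simp add: residue_pattern_def)
  qed
  show ?thesis
  proof (cases C)
    case None
    then show ?thesis using None_Some eq by (cases D) auto
  next
    case (Some W)
    then obtain W' where W': "D = Some W'"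
      using None_Some eq by (cases D) auto
    have "W \<subseteq> {..<q}" "W' \<subseteq> {..<q}"
      using assms(4,5) Some W' by auto
    moreover have "t \<in> W \<longleftrightarrow> t \<in> W'" if "t < q" for t
      using eq[of t] lt[of t] that Some W' by (simp add: residue_pattern_def)
    ultimately have "W = W'" by blast
    then show ?thesis using Some W' by simp
  qed
qed

text \<open>As \<open>p * q\<close> is odd, the negated base is a \<open>p * q\<close>-th root of
  unity. Its \<open>p\<close>-th and \<open>q\<close>-th powers differ from 1, so either periodicity
  makes the sum vanish.\<close>

lemma residue_class_sum:
  assumes "odd p" "odd q" "1 < p" "1 < q"
  shows "(\<Sum>t<p * q. bit_sign (residue_pattern p q c t) * (- cis (pi / real (p * q))) ^ t) = 0"
proof -
  let ?\<zeta> = "- cis (pi / real (p * q))"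
  have pow: "?\<zeta> ^ d = - cis (pi / real e)" if "odd d" "0 < d" "0 < e" "p * q = e * d" for d e
    using that by (simp add: power_minus[of "cis _"] Complex.DeMoivre field_simps)
  have ne: "- cis (pi / real e) \<noteq> 1" if "1 < e" for e
  proof
    assume "- cis (pi / real e) = 1"
    then have "cos (pi / real e) = - 1" by (simp add: complex_eq_iff)
    moreover have "cos pi < cos (pi / real e)"
      using that by (intro cos_monotone_0_pi) (auto simp: field_simps)
    ultimately show False by simp
  qed
  have one: "?\<zeta> ^ (p * q) = 1"
    using pow[of "p * q" 1] assms by simp
  show ?thesis
  proof (cases c)
    case None
    \<comment> \<open>The factors are swapped because the period is now \<open>p\<close>.\<close>
    have "(\<Sum>t<q * p. bit_sign (residue_pattern p q c t) * ?\<zeta> ^ t) = 0"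
    proof (rule sum_periodic_eq_0)
      show "?\<zeta> ^ p \<noteq> 1"
        using pow[of p q] ne[of q] assms by (simp add: mult.commute)
      show "?\<zeta> ^ (q * p) = 1"
        using one by (simp only: mult.commute)
    qed (simp add: None residue_pattern_def)
    then show ?thesis by (simp add: mult.commute)
  next
    case (Some W)
    show ?thesis
    proof (rule sum_periodic_eq_0)
      show "?\<zeta> ^ q \<noteq> 1"
        using pow[of q p] ne[of p] assms by simp
      show "?\<zeta> ^ (p * q) = 1" by (rule one)
    qed (simp add: Some residue_pattern_def)
  qed
qed

text \<open>With \<open>j = t * r + a\<close> the sum splits over the residue classes
  \<open>a\<close>. Equality of two bits multiplies their signs, so comparing with the parity of
  \<open>t\<close> yields \<open>(-1) ^ t\<close>, absorbed by the negated base of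
  \<open>residue_class_sum\<close>.\<close>

lemma mixed_bit_sum:
  assumes "odd p" "odd q" "1 < p" "1 < q" "0 < r"
  shows "(\<Sum>j<p * q * r. bit_sign (mixed_bit p q r f j) * cis (pi / real (p * q * r)) ^ j) = 0"
proof -
  let ?\<omega> = "cis (pi / real (p * q * r))"
  have \<omega>: "?\<omega> ^ r = cis (pi / real (p * q))"
    using assms by (simp add: Complex.DeMoivre)
  have summand: "bit_sign (mixed_bit p q r f (t * r + a)) * ?\<omega> ^ (t * r + a)
      = ?\<omega> ^ a * (bit_sign (residue_pattern p q (f a) t) * (- cis (pi / real (p * q))) ^ t)"
    if "a < r" for a t
  proof -
    have "?\<omega> ^ (t * r + a) = ?\<omega> ^ a * cis (pi / real (p * q)) ^ t"
      unfolding \<omega>[symmetric] by (simp only: power_add mult.commute[of t] power_mult mult.commute[of _ "?\<omega> ^ a"])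
    moreover have "mixed_bit p q r f (t * r + a) \<longleftrightarrow> residue_pattern p q (f a) t = even t"
      using that by (simp add: mixed_bit_def)
    moreover have "(- cis (pi / real (p * q))) ^ t = (-1) ^ t * cis (pi / real (p * q)) ^ t"
      by (rule power_minus)
    ultimately show ?thesis
      by (simp add: minus_one_power_iff)
  qed
  have "(\<Sum>j<p * q * r. bit_sign (mixed_bit p q r f j) * ?\<omega> ^ j)
      = (\<Sum>t<p * q. \<Sum>a<r. ?\<omega> ^ a * (bit_sign (residue_pattern p q (f a) t) * (- cis (pi / real (p * q))) ^ t))"
    unfolding sum_nat_group_mod[of _ "p * q" r] by (intro sum.cong refl) (simp only: summand lessThan_iff)
  also have "\<dots> = (\<Sum>a<r. ?\<omega> ^ a * (\<Sum>t<p * q. bit_sign (residue_pattern p q (f a) t) * (- cis (pi / real (p * q))) ^ t))"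
    by (subst sum.swap) (simp only: sum_distrib_left)
  also have "\<dots> = 0"
    using residue_class_sum[OF assms(1-4)] by (simp only: mult_zero_right sum.neutral_const)
  finally show ?thesis .
qed

text \<open>
  Fixing the classes of \<open>0\<close> and \<open>r - 1\<close> makes the first and the last bit equal, as they must
  be for an odd number of runs.
\<close>

definition pattern_choices :: "nat \<Rightarrow> nat \<Rightarrow> (nat \<Rightarrow> nat set option) set" where
  "pattern_choices q r = {1..<r - 1} \<rightarrow>\<^sub>E insert None (Some ` Pow {..<q})"

definition completed :: "nat \<Rightarrow> nat \<Rightarrow> (nat \<Rightarrow> nat set option) \<Rightarrow> nat \<Rightarrow> nat set option" where
  "completed q r f a = (if a \<in> {1..<r - 1} then f a else Some {..<q})"

lemma card_pattern_choices: "card (pattern_choices q r) = (2 ^ q + 1) ^ (r - 2)"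
proof -
  have "card (insert None (Some ` Pow {..<q})) = 2 ^ q + 1"
    by (subst card_insert_disjoint) (auto simp: card_image card_Pow)
  then show ?thesis
    unfolding pattern_choices_def by (subst card_PiE) (simp_all add: numeral_2_eq_2)
qed

text \<open>The composition determines the bits and the bits determine the chosen patterns, so
  counting the choices counts compositions.\<close>

lemma many_reinhardt_compositions:
  assumes p: "prime p" "odd p" and q: "prime q" "odd q" and "p < q" "3 \<le> r"
  defines "n \<equiv> p * q * r"
  shows "\<exists>S. finite S \<and> card S = (2 ^ q + 1) ^ (r - 2) \<and>
    (\<forall>ks\<in>S. odd_composition n ks \<and> (\<exists>P. reinhardt_composition n P ks))"
proof -
  have gt: "1 < p" "1 < q" "0 < r" using assms prime_gt_1_nat by auto
  then have n: "0 < n" "0 < p * q" by (simp_all add: n_def)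
  define bits where "bits f = map (mixed_bit p q r (completed q r f)) [0..<n]" for f
  have "\<exists>ks. odd_composition n ks \<and> run_bits True ks = bits f" for f
  proof -
    have "hd (bits f)"
      using n gt \<open>3 \<le> r\<close> by (simp add: bits_def hd_map mixed_bit_def completed_def residue_pattern_def)
    moreover have "last (bits f)"
    proof -
      \<comment> \<open>The last position lies in class \<open>r - 1\<close> with the even quotient
        \<open>p * q - 1\<close>, so its bit is true, like that of position 0.\<close>
      have "n - 1 = (r - 1) + (p * q - 1) * r"
        using n gt unfolding n_def by (cases "p * q"; cases r) simp_all
      then have "(n - 1) mod r = r - 1" "(n - 1) div r = p * q - 1"
        using gt by (simp_all only: mod_mult_self1 div_mult_self1) simp_all
      moreover have "even (p * q - 1)"
        using p(2) q(2) n by simp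
      ultimately show ?thesis
        using n gt by (simp add: bits_def last_map mixed_bit_def completed_def residue_pattern_def)
    qed
    ultimately show ?thesis
      using odd_composition_of_bits[of "bits f" n] n by (auto simp: bits_def)
  qed
  then obtain comp where comp: "\<And>f. odd_composition n (comp f)" "\<And>f. run_bits True (comp f) = bits f"
    by metis
  have reinhardt: "\<exists>P. reinhardt_composition n P (comp f)" for f
  proof (rule reinhardt_composition_of_bits[OF comp(1) n(1)])
    show "(\<Sum>j<n. bit_sign (run_bits True (comp f) ! j) * cis (pi / real n) ^ j) = 0"
      using mixed_bit_sum[OF p(2) q(2) gt, of "completed q r f"]
      by (simp add: comp bits_def n_def[symmetric] cong: if_cong)
  qed
  have inj: "inj_on comp (pattern_choices q r)"
  proof (rule inj_onI)
    fix f g assume fg: "f \<in> pattern_choices q r" "g \<in> pattern_choices q r" "comp f = comp g"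
    then have "bits f = bits g" using comp(2) by metis
    then have eq: "mixed_bit p q r (completed q r f) j = mixed_bit p q r (completed q r g) j" if "j < n" for j
      using that by (simp add: bits_def)
    show "f = g"
    proof (rule PiE_ext[OF fg(1,2)[unfolded pattern_choices_def]])
      fix a assume a: "a \<in> {1..<r - 1}"
      show "f a = g a"
      proof (rule residue_pattern_inj[OF p(1) q(1) \<open>p < q\<close>])
        show "f a \<in> insert None (Some ` Pow {..<q})" "g a \<in> insert None (Some ` Pow {..<q})"
          using fg a by (auto simp: pattern_choices_def PiE_iff)
        fix t assume t: "t < p * q"
        have "a < r" using a by auto
        then have "t * r + a < Suc t * r" by simp
        also have "\<dots> \<le> n" unfolding n_def using t by (intro mult_le_mono1) simp
        finally show "residue_pattern p q (f a) t = residue_pattern p q (g a) t"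
          using eq[of "t * r + a"] a \<open>a < r\<close> by (auto simp: mixed_bit_def completed_def)
      qed
    qed
  qed
  show ?thesis
  proof (intro exI[of _ "comp ` pattern_choices q r"] conjI ballI)
    show "card (comp ` pattern_choices q r) = (2 ^ q + 1) ^ (r - 2)"
      by (simp add: card_image[OF inj] card_pattern_choices)
    show "finite (comp ` pattern_choices q r)"
      unfolding pattern_choices_def by (intro finite_imageI finite_PiE) auto
  qed (use comp reinhardt in auto)
qed

section \<open>Counting dihedral classes\<close>

lemma rotate_inverse:
  obtains k where "rotate k (rotate j xs) = xs"
proof
  have "(length xs - j mod length xs + j) mod length xs = 0" if "xs \<noteq> []"
  proof -
    have "j mod length xs \<le> length xs" using that by (simp add: less_imp_le)
    then have "(length xs - j mod length xs + j mod length xs) mod length xs = 0" by simp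
    then show ?thesis by (simp only: mod_add_right_eq)
  qed
  then show "rotate (length xs - j mod length xs) (rotate j xs) = xs"
    unfolding rotate_rotate by (cases "xs = []") simp_all
qed

lemma dihedral_class_sym:
  assumes "ys \<in> dihedral_class xs"
  shows "xs \<in> dihedral_class ys"
proof -
  consider j where "ys = rotate j xs" | j where "ys = rotate j (rev xs)"
    using assms by (auto simp: dihedral_class_def)
  then show ?thesis
  proof cases
    case 1
    then show ?thesis
      using rotate_inverse[of j xs] by (auto simp: dihedral_class_def) metis
  next
    case (2 j)
    obtain k where "rotate k ys = rev xs"
      using rotate_inverse[of j "rev xs"] 2 by metis
    then have "xs = rev (rotate k ys)" by simp
    \<comment> \<open>Reversing a rotation rotates the reversal the other way.\<close>
    also have "\<dots> = rotate (length ys - k mod length ys) (rev ys)"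
    proof (cases "ys = [] \<or> k mod length ys = 0")
      case False
      then have "k mod length ys < length ys" by simp
      with False have "length ys - (length ys - k mod length ys) mod length ys = k mod length ys"
        by simp
      then show ?thesis
        using rotate_rev[of "length ys - k mod length ys" ys] rotate_conv_mod[of k ys] by simp
    qed auto
    finally show ?thesis by (auto simp: dihedral_class_def)
  qed
qed

lemma self_in_dihedral_class: "xs \<in> dihedral_class xs"
proof -
  have "xs = rotate 0 xs" by simp
  then show ?thesis unfolding dihedral_class_def by blast
qed

lemma dihedral_class_finite_card:
  assumes "length xs \<le> l" "xs \<noteq> []"
  shows "finite (dihedral_class xs)" "card (dihedral_class xs) \<le> 2 * l"
proof -
  have rot: "{rotate j ys | j. True} \<subseteq> (\<lambda>j. rotate j ys) ` {..<l}" if "length ys \<le> l" "ys \<noteq> []" for ys :: "nat list"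
  proof
    fix zs assume "zs \<in> {rotate j ys | j. True}"
    then obtain j where "zs = rotate (j mod length ys) ys" using rotate_conv_mod by blast
    moreover have "j mod length ys < l" using that by (meson length_greater_0_conv less_le_trans mod_less_divisor)
    ultimately show "zs \<in> (\<lambda>j. rotate j ys) ` {..<l}" by blast
  qed
  have sub: "dihedral_class xs \<subseteq> (\<lambda>j. rotate j xs) ` {..<l} \<union> (\<lambda>j. rotate j (rev xs)) ` {..<l}" (is "_ \<subseteq> ?A \<union> ?B")
    unfolding dihedral_class_def using rot[of xs] rot[of "rev xs"] assms by (intro Un_mono) auto
  then show "finite (dihedral_class xs)"
    by (rule finite_subset) simp
  have "card (dihedral_class xs) \<le> card (?A \<union> ?B)"
    using sub by (intro card_mono) simp_all
  also have "\<dots> \<le> card ?A + card ?B" by (rule card_Un_le)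
  also have "\<dots> \<le> l + l"
    by (intro add_mono; rule order_trans[OF card_image_le]; simp)
  finally show "card (dihedral_class xs) \<le> 2 * l" by simp
qed

section \<open>Bounds for compositions and for their classes\<close>

lemma length_le_sum_list:
  fixes ks :: "nat list"
  assumes "0 \<notin> set ks"
  shows "length ks \<le> sum_list ks"
  using assms by (induction ks) auto

lemma odd_composition_length:
  assumes "odd_composition n ks"
  shows "ks \<noteq> []" "length ks \<le> n"
  using assms length_le_sum_list[of ks] by (auto simp: odd_composition_def)

text \<open>A list of sum \<open>N + 1\<close> arises from one of sum \<open>N\<close> by prepending
  1 or by raising the first entry, so the count at most doubles.\<close>

lemma card_positive_lists:
  "finite {us :: nat list. sum_list us = N \<and> 0 \<notin> set us} \<and> card {us :: nat list. sum_list us = N \<and> 0 \<notin> set us} \<le> 2 ^ N"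
proof (induction N)
  case 0
  have "us = []" if "sum_list us = 0" "0 \<notin> set us" for us :: "nat list"
    using length_le_sum_list[OF that(2)] that(1) by simp
  then have "{us :: nat list. sum_list us = 0 \<and> 0 \<notin> set us} \<subseteq> {[]}"
    by blast
  then show ?case
    using card_mono[of "{[] :: nat list}"] by (auto intro: finite_subset)
next
  case (Suc N)
  let ?S = "\<lambda>N. {us :: nat list. sum_list us = N \<and> 0 \<notin> set us}"
  have sub: "?S (Suc N) \<subseteq> (#) 1 ` ?S N \<union> (\<lambda>us. Suc (hd us) # tl us) ` ?S N" (is "_ \<subseteq> ?A \<union> ?B")
  proof
    fix us assume us: "us \<in> ?S (Suc N)"
    then obtain v vs where v: "us = v # vs" by (cases us) auto
    show "us \<in> ?A \<union> ?B"
    proof (cases "v = 1")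
      case True
      then show ?thesis using us v by auto
    next
      case False
      then obtain w where "v = Suc w" "w \<noteq> 0" using us v by (cases v) auto
      then have "us = Suc (hd (w # vs)) # tl (w # vs)" "w # vs \<in> ?S N" using us v by auto
      then show ?thesis by blast
    qed
  qed
  have "card (?S (Suc N)) \<le> card (?A \<union> ?B)"
    using sub Suc by (intro card_mono) simp_all
  also have "\<dots> \<le> card ?A + card ?B" by (rule card_Un_le)
  also have "\<dots> \<le> card (?S N) + card (?S N)"
    using Suc by (intro add_mono card_image_le) simp_all
  also have "\<dots> \<le> 2 ^ Suc N" using Suc by simp
  finally show ?case
    using sub Suc finite_subset[OF sub] by simp
qed

lemma finite_odd_compositions: "finite {ks. odd_composition n ks}"
  by (rule finite_subset[OF _ conjunct1[OF card_positive_lists[of n]]]) (auto simp: odd_composition_def)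

lemma finite_reinhardt_classes: "finite (reinhardt_classes n)"
proof -
  have "reinhardt_classes n \<subseteq> dihedral_class ` {ks. odd_composition n ks}"
    by (auto simp: reinhardt_classes_def reinhardt_composition_def)
  then show ?thesis using finite_odd_compositions finite_subset by blast
qed

lemma card_le_num_reinhardt:
  assumes S: "finite S" "\<And>ks. ks \<in> S \<Longrightarrow> odd_composition n ks \<and> (\<exists>P. reinhardt_composition n P ks)"
  shows "card S \<le> num_reinhardt n * (2 * n)"
proof -
  have orbit: "finite C" "card C \<le> 2 * n" if "C \<in> reinhardt_classes n" for C
    using that dihedral_class_finite_card[OF odd_composition_length(2,1)]
    by (auto simp: reinhardt_classes_def reinhardt_composition_def)
  have "S \<subseteq> \<Union> (reinhardt_classes n)"
    using S(2) self_in_dihedral_class by (fastforce simp: reinhardt_classes_def)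
  then have "card S \<le> card (\<Union> (reinhardt_classes n))"
    using orbit finite_reinhardt_classes by (intro card_mono) auto
  also have "\<dots> \<le> (\<Sum>C\<in>reinhardt_classes n. card C)"
    by (rule card_Union_le_sum_card)
  also have "\<dots> \<le> (\<Sum>C\<in>reinhardt_classes n. 2 * n)"
    by (intro sum_mono orbit)
  finally show ?thesis by (simp add: num_reinhardt_def)
qed

lemma sum_list_concat_replicate:
  fixes us :: "nat list"
  shows "sum_list (concat (replicate d us)) = d * sum_list us"
  by (induction d) simp_all

lemma length_concat_replicate: "length (concat (replicate d us)) = d * length us"
  by (induction d) simp_all

lemma dihedral_class_odd_composition:
  assumes "odd_composition n ks" "ys \<in> dihedral_class ks"
  shows "odd_composition n ys"
proof -
  have "mset (rotate j xs) = mset xs" for j and xs :: "nat list"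
  proof (induction j)
    case (Suc j)
    have "mset (rotate1 zs) = mset zs" for zs :: "nat list"
      by (cases zs) simp_all
    with Suc show ?case by simp
  qed simp
  then have "mset ys = mset ks"
    using assms(2) by (auto simp: dihedral_class_def)
  then have "sum_list ys = sum_list ks" "set ys = set ks" "length ys = length ks"
    by (metis sum_mset_sum_list, metis set_mset_mset, metis size_mset)
  then show ?thesis using assms(1) by (simp add: odd_composition_def)
qed

text \<open>In a \<open>d\<close>-fold repetition \<open>d\<close> divides \<open>n\<close> and the
  odd length, so \<open>d\<close> is odd and at least \<open>p\<close>. The repeated block is a
  composition of \<open>n div d\<close>, which is at most \<open>n div p\<close>.\<close>

lemma card_periodic_classes:
  assumes "0 < n" "0 < p" "p dvd n" and div: "\<And>d. odd d \<Longrightarrow> 1 < d \<Longrightarrow> d dvd n \<Longrightarrow> p \<le> d"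
  shows "card {C \<in> reinhardt_classes n. periodic_dihedral C} \<le> 2 * n * (n * 2 ^ (n div p))"
proof -
  let ?S = "\<lambda>N. {us :: nat list. sum_list us = N \<and> 0 \<notin> set us}"
  define W where "W = {ks. odd_composition n ks \<and> (\<exists>d us. d > 1 \<and> ks = concat (replicate d us))}"
  have finW: "finite W"
    unfolding W_def by (rule finite_subset[OF _ finite_odd_compositions]) auto
  have W_sub: "W \<subseteq> (\<Union>d\<in>{p..n}. (\<lambda>us. concat (replicate d us)) ` ?S (n div d))"
  proof
    fix ks assume "ks \<in> W"
    then obtain d us where d: "d > 1" "ks = concat (replicate d us)" "odd_composition n ks"
      by (auto simp: W_def)
    then have n: "n = d * sum_list us" and "odd (d * length us)" "0 \<notin> set us"
      using \<open>0 < n\<close> by (auto simp: odd_composition_def sum_list_concat_replicate length_concat_replicate)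
    then have "p \<le> d" using div[of d] d by simp
    moreover have "d \<le> n" using n \<open>0 < n\<close> by (cases "sum_list us") auto
    moreover have "us \<in> ?S (n div d)" using n d \<open>0 \<notin> set us\<close> by simp
    ultimately show "ks \<in> (\<Union>d\<in>{p..n}. (\<lambda>us. concat (replicate d us)) ` ?S (n div d))"
      using d(2) by auto
  qed
  have "card W \<le> (\<Sum>d\<in>{p..n}. card ((\<lambda>us. concat (replicate d us)) ` ?S (n div d)))"
    using card_positive_lists by (intro order_trans[OF card_mono[OF _ W_sub] card_UN_le]) auto
  also have "\<dots> \<le> (\<Sum>d\<in>{p..n}. 2 ^ (n div p))"
  proof (rule sum_mono)
    fix d assume d: "d \<in> {p..n}"
    have "card ((\<lambda>us. concat (replicate d us)) ` ?S (n div d)) \<le> 2 ^ (n div d)"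
      using card_positive_lists[of "n div d"] card_image_le order_trans by blast
    also have "\<dots> \<le> 2 ^ (n div p)"
      using d \<open>0 < p\<close> by (intro power_increasing div_le_mono2) auto
    finally show "card ((\<lambda>us. concat (replicate d us)) ` ?S (n div d)) \<le> 2 ^ (n div p)" .
  qed
  also have "\<dots> \<le> n * 2 ^ (n div p)"
    using \<open>0 < p\<close> by simp
  finally have W: "card W \<le> n * 2 ^ (n div p)" .
  \<comment> \<open>By symmetry the representative \<open>ks\<close> lies in the class of the
    periodic word; counting all members of such classes costs the factor
    \<open>2 * n\<close>.\<close>
  have sub: "{C \<in> reinhardt_classes n. periodic_dihedral C} \<subseteq> dihedral_class ` (\<Union>w\<in>W. dihedral_class w)"
  proof
    fix C assume "C \<in> {C \<in> reinhardt_classes n. periodic_dihedral C}"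
    then obtain ks d us where C: "C = dihedral_class ks" "odd_composition n ks" "d > 1"
      "concat (replicate d us) \<in> C"
      by (auto simp: reinhardt_classes_def reinhardt_composition_def periodic_dihedral_def)
    then have "concat (replicate d us) \<in> W"
      using dihedral_class_odd_composition unfolding W_def by blast
    then have "ks \<in> (\<Union>w\<in>W. dihedral_class w)"
      using C dihedral_class_sym by blast
    then show "C \<in> dihedral_class ` (\<Union>w\<in>W. dihedral_class w)"
      using C(1) by blast
  qed
  have orbit: "finite (dihedral_class w)" "card (dihedral_class w) \<le> 2 * n" if "w \<in> W" for w
    using that dihedral_class_finite_card[OF odd_composition_length(2,1)] by (auto simp: W_def)
  have fin: "finite (\<Union>w\<in>W. dihedral_class w)"
    using finW orbit by auto
  have "card {C \<in> reinhardt_classes n. periodic_dihedral C} \<le> card (\<Union>w\<in>W. dihedral_class w)"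
    using fin by (intro order_trans[OF card_mono[OF _ sub] card_image_le]) simp_all
  also have "\<dots> \<le> (\<Sum>w\<in>W. card (dihedral_class w))"
    using finW by (rule card_UN_le)
  also have "\<dots> \<le> (\<Sum>w\<in>W. 2 * n)"
    by (intro sum_mono orbit)
  also have "\<dots> = card W * (2 * n)" by simp
  also have "\<dots> \<le> n * 2 ^ (n div p) * (2 * n)"
    using W by (rule mult_le_mono1)
  finally show ?thesis by (simp only: mult_ac)
qed

text \<open>A prime factor of \<open>d\<close> is odd and divides \<open>p\<close>, \<open>q\<close>
  or \<open>r\<close>.\<close>

lemma odd_divisor_ge:
  fixes p q r :: nat
  assumes "prime p" "prime q" "p < q" and r: "\<And>s. prime s \<Longrightarrow> odd s \<Longrightarrow> s dvd r \<Longrightarrow> p \<le> s"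
    and d: "odd d" "1 < d" "d dvd p * q * r"
  shows "p \<le> d"
proof -
  obtain s where s: "prime s" "s dvd d"
    using prime_factor_nat[of d] d by auto
  then have "s dvd p * q * r" "odd s" "s \<le> d"
    using d by (auto dest: dvd_trans intro: dvd_imp_le)
  then have "s dvd p \<or> s dvd q \<or> s dvd r"
    using s by (simp add: prime_dvd_mult_iff)
  then have "p \<le> s"
    using assms(1-3) s r[of s] \<open>odd s\<close> primes_dvd_imp_eq[of s p] primes_dvd_imp_eq[of s q] by auto
  then show ?thesis using \<open>s \<le> d\<close> by simp
qed

section \<open>The limit\<close>

text \<open>With \<open>z\<close> the cube root of \<open>y\<close>, the quotient is the cube of
  \<open>r / z ^ r\<close>.\<close>

lemma cube_over_power_tendsto_0:
  fixes y :: real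
  assumes "1 < y"
  shows "(\<lambda>r. real r ^ 3 / y ^ r) \<longlonglongrightarrow> 0"
proof -
  define z where "z = root 3 y"
  have z: "1 < z" "z ^ 3 = y"
    using assms by (simp_all add: z_def)
  have "(\<lambda>r. (real r / z ^ r) ^ 3) \<longlonglongrightarrow> 0 ^ 3"
    using z(1) by (intro tendsto_power lim_n_over_pown) simp
  moreover have "(real r / z ^ r) ^ 3 = real r ^ 3 / y ^ r" for r
    by (simp add: power_divide z(2)[symmetric] power_mult[symmetric] mult.commute)
  ultimately show ?thesis by simp
qed

theorem theorem1p3:
  fixes p q :: nat and \<epsilon> :: real
  assumes "prime p" and "odd p" and "prime q" and "odd q" and "p < q" and "\<epsilon> > 0"
  shows "\<exists>N. \<forall>r\<ge>N. (\<forall>s. prime s \<and> odd s \<and> s dvd r \<longrightarrow> p \<le> s) \<longrightarrow>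
           real (num_sporadic (p * q * r)) / real (num_reinhardt (p * q * r))
             > (2 ^ p - 2) / (real p * 2 ^ q + 2 ^ p - 2) - \<epsilon>"
proof -
  \<comment> \<open>Here \<open>y\<close> compares the growth in \<open>r\<close> of the constructed
    compositions with that of the periodic bound, and \<open>c\<close> collects the factors free of
    \<open>r\<close>.\<close>
  define y :: real where "y = (2 ^ q + 1) / 2 ^ q"
  define c :: real where "c = 4 * real (p * q) ^ 3 * (2 ^ q + 1) ^ 2"
  have "1 < y" by (simp add: y_def field_simps)
  then have "(\<lambda>r. c * (real r ^ 3 / y ^ r)) \<longlonglongrightarrow> c * 0"
    by (intro tendsto_mult tendsto_const cube_over_power_tendsto_0)
  then have "\<forall>\<^sub>F r in sequentially. c * (real r ^ 3 / y ^ r) < \<epsilon>"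
    using \<open>\<epsilon> > 0\<close> by (intro order_tendstoD(2)) simp_all
  then obtain N where N: "\<And>r. r \<ge> N \<Longrightarrow> c * (real r ^ 3 / y ^ r) < \<epsilon>"
    by (auto simp: eventually_sequentially)
  show ?thesis
  proof (intro exI[of _ "max N 3"] allI impI)
    fix r assume r: "r \<ge> max N 3" "\<forall>s. prime s \<and> odd s \<and> s dvd r \<longrightarrow> p \<le> s"
    define n where "n = p * q * r"
    define E where "E = real (num_reinhardt n)"
    define E0 where "E0 = real (card {C \<in> reinhardt_classes n. periodic_dihedral C})"
    have pq: "1 < p" "1 < q" using assms prime_gt_1_nat by auto
    then have n: "0 < n" "n div p = q * r" using r by (simp_all add: n_def)
    have E0: "E0 \<le> 2 * real n ^ 2 * 2 ^ (q * r)"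
    proof -
      have "card {C \<in> reinhardt_classes n. periodic_dihedral C} \<le> 2 * n * (n * 2 ^ (n div p))"
        using pq n r odd_divisor_ge[OF assms(1,3,5), of r]
        by (intro card_periodic_classes) (auto simp: n_def)
      then have "E0 \<le> real (2 * n * (n * 2 ^ (n div p)))"
        unfolding E0_def by (rule of_nat_mono)
      then show ?thesis by (simp add: n(2) power2_eq_square)
    qed
    obtain S where S: "finite S" "card S = (2 ^ q + 1) ^ (r - 2)"
      "\<And>ks. ks \<in> S \<Longrightarrow> odd_composition n ks \<and> (\<exists>P. reinhardt_composition n P ks)"
      using many_reinhardt_compositions[OF assms(1-5), of r] r unfolding n_def by auto
    have E: "(2 ^ q + 1) ^ (r - 2) \<le> E * (2 * real n)"
    proof -
      have "real (card S) \<le> real (num_reinhardt n * (2 * n))"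
        using card_le_num_reinhardt[OF S(1,3)] by (intro of_nat_mono) blast
      then show ?thesis by (simp add: S(2) E_def add.commute)
    qed
    have "0 < (2 ^ q + 1 :: real) ^ (r - 2)"
      by (simp add: add_pos_pos)
    with E have E_pos: "E > 0"
      using n(1) by (metis less_le_trans mult_pos_pos of_nat_0_less_iff zero_less_mult_pos2 zero_less_numeral)
    have "E0 / E \<le> c * (real r ^ 3 / y ^ r)"
    proof -
      \<comment> \<open>Raising the exponent from \<open>r - 2\<close> to \<open>r\<close> costs the
        factor \<open>(2 ^ q + 1) ^ 2\<close> in \<open>c\<close>.\<close>
      have "r = r - 2 + 2" using r(1) by linarith
      then have "(2 ^ q + 1 :: real) ^ r = (2 ^ q + 1) ^ (r - 2) * (2 ^ q + 1) ^ 2"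
        by (metis power_add)
      also have "\<dots> \<le> E * (2 * real n) * (2 ^ q + 1) ^ 2"
        using E by (intro mult_right_mono) simp_all
      finally have *: "(2 ^ q + 1 :: real) ^ r \<le> E * (2 * real n) * (2 ^ q + 1) ^ 2" .
      have "E0 * (2 ^ q + 1) ^ r \<le> (2 * real n ^ 2 * 2 ^ (q * r)) * (E * (2 * real n) * (2 ^ q + 1) ^ 2)"
        using E0 * by (intro mult_mono) (simp_all add: E0_def)
      also have "\<dots> = c * real r ^ 3 * 2 ^ (q * r) * E"
        by (simp add: c_def n_def power2_eq_square power3_eq_cube)
      finally have "E0 / E \<le> c * real r ^ 3 * 2 ^ (q * r) / (2 ^ q + 1) ^ r"
        using E_pos by (simp add: field_simps add_pos_pos)
      also have "\<dots> = c * (real r ^ 3 / y ^ r)"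
        by (simp add: y_def power_divide power_mult)
      finally show ?thesis .
    qed
    then have small: "E0 / E < \<epsilon>"
      using N[of r] r by simp
    have "card (reinhardt_classes n) = card ({C \<in> reinhardt_classes n. periodic_dihedral C}
        \<union> {C \<in> reinhardt_classes n. \<not> periodic_dihedral C})"
      by (rule arg_cong[where f = card]) auto
    also have "\<dots> = card {C \<in> reinhardt_classes n. periodic_dihedral C} + num_sporadic n"
      unfolding num_sporadic_def using finite_reinhardt_classes[of n] by (intro card_Un_disjoint) auto
    finally have "real (num_sporadic n) / E = 1 - E0 / E"
      using E_pos by (simp add: E_def E0_def num_reinhardt_def field_simps)
    \<comment> \<open>The sporadic fraction exceeds \<open>1 - \<epsilon>\<close>, so this crude
      bound suffices.\<close>
    moreover have "(2 ^ p - 2) / (real p * 2 ^ q + 2 ^ p - 2) \<le> 1"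
    proof -
      have "(2 :: real) ^ 1 \<le> 2 ^ p" using pq by (intro power_increasing) simp_all
      moreover have "0 < real p * 2 ^ q" using pq by simp
      ultimately show ?thesis by simp
    qed
    ultimately show "real (num_sporadic (p * q * r)) / real (num_reinhardt (p * q * r))
             > (2 ^ p - 2) / (real p * 2 ^ q + 2 ^ p - 2) - \<epsilon>"
      using small unfolding n_def[symmetric] E_def[symmetric] by linarith
  qed
qed

end
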